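(* Let $\mathcal{A}$ be an abelian category and $\mathcal{W}$ a subcategory of $\mathcal{A}$. If $\mathcal{W}\perp\mathcal{W}$, then $\mathcal{G}(\mathcal{W})$ is closed under direct summands.
   Context: "Subcategory" means full additive subcategory closed under isomorphisms. $\mathcal{W}\perp\mathcal{W}$ means $\operatorname{Ext}^{i}_{\mathcal{A}}(W,W')=0$ for all $i\geq 1$ and all objects $W,W'\in\mathcal{W}$. An exact complex $X=\cdots\to X_1\xrightarrow{\partial^X_1}X_0\xrightarrow{\partial^X_0}X_{-1}\to\cdots$ of objects in $\mathcal{W}$ is totally $\mathcal{W}$-acyclic if $\operatorname{Hom}_{\mathcal{A}}(W,X)$ and $\operatorname{Hom}_{\mathcal{A}}(X,W)$ are exact for every object $W$ in $\mathcal{W}$. $\mathcal{G}(\mathcal{W})$ is the subcategory of objects $M\cong\operatorname{Coker}(\partial^X_1)$ for some totally $\mathcal{W}$-acyclic complex $X$. *)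

theory Defs
  imports "HOL-Algebra.Exact_Sequence"
begin

section \<open>Categories with abelian groups of morphisms\<close>

record ('o, 'm) category_data =
  Obj :: "'o set"
  Arr :: "'m set"
  Dom :: "'m \<Rightarrow> 'o"
  Cod :: "'m \<Rightarrow> 'o"
  Id :: "'o \<Rightarrow> 'm"
  Comp :: "'m \<Rightarrow> 'm \<Rightarrow> 'm"  (infixl "\<cdot>\<index>" 70)

record ('o, 'm) preadditive_data = "('o, 'm) category_data" +
  Plus :: "'m \<Rightarrow> 'm \<Rightarrow> 'm"
  Null :: "'o \<Rightarrow> 'o \<Rightarrow> 'm"

definition Hom :: "('o, 'm, 'z) category_data_scheme \<Rightarrow> 'o \<Rightarrow> 'o \<Rightarrow> 'm set" where
  "Hom C A B = {f \<in> Arr C. Dom C f = A \<and> Cod C f = B}"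

locale category =
  fixes C :: "('o, 'm, 'z) category_data_scheme" (structure)
  assumes Dom_in_Obj: "f \<in> Arr C \<Longrightarrow> Dom C f \<in> Obj C"
    and Cod_in_Obj: "f \<in> Arr C \<Longrightarrow> Cod C f \<in> Obj C"
    and Id_in_Hom: "A \<in> Obj C \<Longrightarrow> Id C A \<in> Hom C A A"
    and Comp_in_Hom: "\<lbrakk>f \<in> Hom C A B; g \<in> Hom C B D\<rbrakk> \<Longrightarrow> g \<cdot> f \<in> Hom C A D"
    and Id_left: "f \<in> Hom C A B \<Longrightarrow> Id C B \<cdot> f = f"
    and Id_right: "f \<in> Hom C A B \<Longrightarrow> f \<cdot> Id C A = f"
    and Comp_assoc: "\<lbrakk>f \<in> Hom C A B; g \<in> Hom C B D; h \<in> Hom C D E\<rbrakk>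
      \<Longrightarrow> (h \<cdot> g) \<cdot> f = h \<cdot> (g \<cdot> f)"

text \<open>The abelian group of morphisms, in the multiplicative records of HOL-Algebra, so that
  \<open>kernel\<close>, \<open>exact_seq\<close> etc. apply to it.\<close>

definition Hom_group ::
  "('o, 'm, 'z) preadditive_data_scheme \<Rightarrow> 'o \<Rightarrow> 'o \<Rightarrow> 'm monoid" where
  "Hom_group C A B = \<lparr>carrier = Hom C A B, mult = Plus C, one = Null C A B\<rparr>"

locale preadditive_category = category C
  for C :: "('o, 'm, 'z) preadditive_data_scheme" (structure) +
  assumes Hom_comm_group: "\<lbrakk>A \<in> Obj C; B \<in> Obj C\<rbrakk> \<Longrightarrow> comm_group (Hom_group C A B)"
    and Comp_Plus_left: "\<lbrakk>f \<in> Hom C A B; g \<in> Hom C B D; g' \<in> Hom C B D\<rbrakk>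
      \<Longrightarrow> Plus C g g' \<cdot> f = Plus C (g \<cdot> f) (g' \<cdot> f)"
    and Comp_Plus_right: "\<lbrakk>f \<in> Hom C A B; f' \<in> Hom C A B; g \<in> Hom C B D\<rbrakk>
      \<Longrightarrow> g \<cdot> Plus C f f' = Plus C (g \<cdot> f) (g \<cdot> f')"

definition is_mono :: "('o, 'm, 'z) category_data_scheme \<Rightarrow> 'm \<Rightarrow> bool" where
  "is_mono C f \<longleftrightarrow> f \<in> Arr C \<and>
    (\<forall>g\<in>Arr C. \<forall>h\<in>Arr C. Cod C g = Dom C f \<and> Cod C h = Dom C f \<and> Dom C g = Dom C h \<and>
       f \<cdot>\<^bsub>C\<^esub> g = f \<cdot>\<^bsub>C\<^esub> h \<longrightarrow> g = h)"

definition is_epi :: "('o, 'm, 'z) category_data_scheme \<Rightarrow> 'm \<Rightarrow> bool" where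
  "is_epi C f \<longleftrightarrow> f \<in> Arr C \<and>
    (\<forall>g\<in>Arr C. \<forall>h\<in>Arr C. Dom C g = Cod C f \<and> Dom C h = Cod C f \<and> Cod C g = Cod C h \<and>
       g \<cdot>\<^bsub>C\<^esub> f = h \<cdot>\<^bsub>C\<^esub> f \<longrightarrow> g = h)"

definition isomorphic :: "('o, 'm, 'z) category_data_scheme \<Rightarrow> 'o \<Rightarrow> 'o \<Rightarrow> bool" where
  "isomorphic C A B \<longleftrightarrow> A \<in> Obj C \<and> B \<in> Obj C \<and>
    (\<exists>f\<in>Hom C A B. \<exists>g\<in>Hom C B A. g \<cdot>\<^bsub>C\<^esub> f = Id C A \<and> f \<cdot>\<^bsub>C\<^esub> g = Id C B)"

definition zero_object :: "('o, 'm, 'z) category_data_scheme \<Rightarrow> 'o \<Rightarrow> bool" where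
  "zero_object C Z \<longleftrightarrow> Z \<in> Obj C \<and>
    (\<forall>A\<in>Obj C. (\<exists>!f. f \<in> Hom C A Z) \<and> (\<exists>!f. f \<in> Hom C Z A))"

text \<open>\<open>S\<close> is a direct sum of \<open>A\<close> and \<open>B\<close> with injections \<open>i\<close>, \<open>j\<close> and projections
  \<open>p\<close>, \<open>q\<close>. Any object isomorphic to a direct sum of \<open>A\<close> and \<open>B\<close> is one in this sense.\<close>

definition is_biproduct :: "('o, 'm, 'z) preadditive_data_scheme
    \<Rightarrow> 'o \<Rightarrow> 'o \<Rightarrow> 'o \<Rightarrow> 'm \<Rightarrow> 'm \<Rightarrow> 'm \<Rightarrow> 'm \<Rightarrow> bool" where
  "is_biproduct C A B S i j p q \<longleftrightarrow> A \<in> Obj C \<and> B \<in> Obj C \<and> S \<in> Obj C \<and>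
    i \<in> Hom C A S \<and> j \<in> Hom C B S \<and> p \<in> Hom C S A \<and> q \<in> Hom C S B \<and>
    p \<cdot>\<^bsub>C\<^esub> i = Id C A \<and> q \<cdot>\<^bsub>C\<^esub> j = Id C B \<and>
    q \<cdot>\<^bsub>C\<^esub> i = Null C A B \<and> p \<cdot>\<^bsub>C\<^esub> j = Null C B A \<and>
    Plus C (i \<cdot>\<^bsub>C\<^esub> p) (j \<cdot>\<^bsub>C\<^esub> q) = Id C S"

definition is_kernel :: "('o, 'm, 'z) preadditive_data_scheme \<Rightarrow> 'm \<Rightarrow> 'm \<Rightarrow> bool" where
  "is_kernel C k f \<longleftrightarrow> k \<in> Arr C \<and> f \<in> Arr C \<and> Cod C k = Dom C f \<and>
    f \<cdot>\<^bsub>C\<^esub> k = Null C (Dom C k) (Cod C f) \<and>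
    (\<forall>h\<in>Arr C. Cod C h = Dom C f \<and> f \<cdot>\<^bsub>C\<^esub> h = Null C (Dom C h) (Cod C f) \<longrightarrow>
       (\<exists>!u. u \<in> Hom C (Dom C h) (Dom C k) \<and> k \<cdot>\<^bsub>C\<^esub> u = h))"

definition is_cokernel :: "('o, 'm, 'z) preadditive_data_scheme \<Rightarrow> 'm \<Rightarrow> 'm \<Rightarrow> bool" where
  "is_cokernel C c f \<longleftrightarrow> c \<in> Arr C \<and> f \<in> Arr C \<and> Dom C c = Cod C f \<and>
    c \<cdot>\<^bsub>C\<^esub> f = Null C (Dom C f) (Cod C c) \<and>
    (\<forall>h\<in>Arr C. Dom C h = Cod C f \<and> h \<cdot>\<^bsub>C\<^esub> f = Null C (Dom C f) (Cod C h) \<longrightarrow>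
       (\<exists>!u. u \<in> Hom C (Cod C c) (Cod C h) \<and> u \<cdot>\<^bsub>C\<^esub> c = h))"

locale abelian_category = preadditive_category C
  for C :: "('o, 'm, 'z) preadditive_data_scheme" (structure) +
  assumes ex_zero_object: "\<exists>Z. zero_object C Z"
    and ex_biproduct: "\<lbrakk>A \<in> Obj C; B \<in> Obj C\<rbrakk> \<Longrightarrow> \<exists>S i j p q. is_biproduct C A B S i j p q"
    and ex_kernel: "f \<in> Arr C \<Longrightarrow> \<exists>k. is_kernel C k f"
    and ex_cokernel: "f \<in> Arr C \<Longrightarrow> \<exists>c. is_cokernel C c f"
    and mono_is_kernel: "is_mono C f \<Longrightarrow> \<exists>g. is_kernel C f g"
    and epi_is_cokernel: "is_epi C f \<Longrightarrow> \<exists>g. is_cokernel C f g"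


section \<open>Exactness\<close>

definition is_image :: "('o, 'm, 'z) preadditive_data_scheme \<Rightarrow> 'm \<Rightarrow> 'm \<Rightarrow> bool" where
  "is_image C m f \<longleftrightarrow> (\<exists>c. is_cokernel C c f \<and> is_kernel C m c)"

definition exact_at :: "('o, 'm, 'z) preadditive_data_scheme \<Rightarrow> 'm \<Rightarrow> 'm \<Rightarrow> bool" where
  "exact_at C f g \<longleftrightarrow> f \<in> Arr C \<and> g \<in> Arr C \<and> Cod C f = Dom C g \<and>
    (\<exists>k. is_image C k f \<and> is_kernel C k g)"


section \<open>Yoneda Ext\<close>

text \<open>An exact sequence \<open>0 \<rightarrow> B \<rightarrow> E\<^sub>n \<rightarrow> \<dots> \<rightarrow> E\<^sub>1 \<rightarrow> A \<rightarrow> 0\<close> is encoded, for \<open>n \<ge> 1\<close>, as the list of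
  its \<open>n + 1\<close> arrows from \<open>B \<rightarrow> E\<^sub>n\<close> to \<open>E\<^sub>1 \<rightarrow> A\<close>.\<close>

definition extensions ::
  "('o, 'm, 'z) preadditive_data_scheme \<Rightarrow> nat \<Rightarrow> 'o \<Rightarrow> 'o \<Rightarrow> 'm list set" where
  "extensions C n A B = {fs. length fs = Suc n \<and>
    is_mono C (hd fs) \<and> Dom C (hd fs) = B \<and> is_epi C (last fs) \<and> Cod C (last fs) = A \<and>
    (\<forall>i<n. exact_at C (fs ! i) (fs ! Suc i))}"

definition extension_morphism :: "('o, 'm, 'z) preadditive_data_scheme
    \<Rightarrow> nat \<Rightarrow> 'o \<Rightarrow> 'o \<Rightarrow> 'm list \<Rightarrow> 'm list \<Rightarrow> 'm list \<Rightarrow> bool" where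
  "extension_morphism C n A B as fs gs \<longleftrightarrow>
    fs \<in> extensions C n A B \<and> gs \<in> extensions C n A B \<and>
    length as = n + 2 \<and> as ! 0 = Id C B \<and> as ! (n + 1) = Id C A \<and>
    (\<forall>i\<le>n. as ! i \<in> Hom C (Dom C (fs ! i)) (Dom C (gs ! i)) \<and>
           as ! Suc i \<in> Hom C (Cod C (fs ! i)) (Cod C (gs ! i)) \<and>
           as ! Suc i \<cdot>\<^bsub>C\<^esub> fs ! i = gs ! i \<cdot>\<^bsub>C\<^esub> as ! i)"

text \<open>The equivalence relation generated by morphisms of extensions that are the identity on \<open>A\<close>
  and \<open>B\<close>; identity morphisms make the transitive closure below reflexive on extensions.\<close>

definition yoneda_equiv :: "('o, 'm, 'z) preadditive_data_scheme
    \<Rightarrow> nat \<Rightarrow> 'o \<Rightarrow> 'o \<Rightarrow> ('m list \<times> 'm list) set" where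
  "yoneda_equiv C n A B =
    (let r = {(fs, gs). \<exists>as. extension_morphism C n A B as fs gs} in (r \<union> r\<inverse>)\<^sup>+)"

definition Ext :: "('o, 'm, 'z) preadditive_data_scheme
    \<Rightarrow> nat \<Rightarrow> 'o \<Rightarrow> 'o \<Rightarrow> 'm list set set" where
  "Ext C n A B = extensions C n A B // yoneda_equiv C n A B"

text \<open>For \<open>n = 1\<close> these are the split sequences \<open>0 \<rightarrow> B \<rightarrow> B \<oplus> A \<rightarrow> A \<rightarrow> 0\<close>, and for \<open>n \<ge> 2\<close> the sequences
  \<open>0 \<rightarrow> B = B \<rightarrow> 0 \<rightarrow> \<dots> \<rightarrow> 0 \<rightarrow> A = A \<rightarrow> 0\<close>: exactness forces the objects between zero arrows to vanish.\<close>

definition trivial_extension :: "('o, 'm, 'z) preadditive_data_scheme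
    \<Rightarrow> nat \<Rightarrow> 'o \<Rightarrow> 'o \<Rightarrow> 'm list \<Rightarrow> bool" where
  "trivial_extension C n A B fs \<longleftrightarrow> fs \<in> extensions C n A B \<and>
    (if n = 1 then \<exists>S i j p q. is_biproduct C B A S i j p q \<and> fs = [i, q]
     else fs ! 0 = Id C B \<and> fs ! n = Id C A \<and>
       (\<forall>k. 0 < k \<and> k < n \<longrightarrow> fs ! k = Null C (Dom C (fs ! k)) (Cod C (fs ! k))))"

definition Ext_zero :: "('o, 'm, 'z) preadditive_data_scheme
    \<Rightarrow> nat \<Rightarrow> 'o \<Rightarrow> 'o \<Rightarrow> 'm list set" where
  "Ext_zero C n A B = yoneda_equiv C n A B `` {fs. trivial_extension C n A B fs}"

text \<open>\<open>Ext_zero\<close> is the neutral element for the Baer sum, so a group \<open>Ext\<close> vanishes iff its underlying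
  set consists of this class alone.\<close>

definition Ext_orthogonal :: "('o, 'm, 'z) preadditive_data_scheme
    \<Rightarrow> 'o set \<Rightarrow> 'o set \<Rightarrow> bool" where
  "Ext_orthogonal C V W \<longleftrightarrow>
    (\<forall>i\<ge>1. \<forall>A\<in>V. \<forall>B\<in>W. Ext C i A B = {Ext_zero C i A B})"


section \<open>Subcategories and totally acyclic complexes\<close>

text \<open>A full subcategory is represented by its set of objects.\<close>

definition full_additive_subcategory ::
  "('o, 'm, 'z) preadditive_data_scheme \<Rightarrow> 'o set \<Rightarrow> bool" where
  "full_additive_subcategory C W \<longleftrightarrow> W \<subseteq> Obj C \<and>
    (\<exists>Z\<in>W. zero_object C Z) \<and>
    (\<forall>A\<in>W. \<forall>B\<in>W. \<exists>S\<in>W. \<exists>i j p q. is_biproduct C A B S i j p q) \<and>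
    (\<forall>A\<in>W. \<forall>B. isomorphic C A B \<longrightarrow> B \<in> W)"

definition exact_complex :: "('o, 'm, 'z) preadditive_data_scheme
    \<Rightarrow> (int \<Rightarrow> 'o) \<Rightarrow> (int \<Rightarrow> 'm) \<Rightarrow> bool" where
  "exact_complex C X d \<longleftrightarrow>
    (\<forall>n. X n \<in> Obj C \<and> d n \<in> Hom C (X n) (X (n - 1)) \<and>
      d n \<cdot>\<^bsub>C\<^esub> d (n + 1) = Null C (X (n + 1)) (X (n - 1)) \<and>
      exact_at C (d (n + 1)) (d n))"

text \<open>\<open>exact_seq\<close> lists groups and homomorphisms from the target to the source.\<close>

definition totally_acyclic :: "('o, 'm, 'z) preadditive_data_scheme
    \<Rightarrow> 'o set \<Rightarrow> (int \<Rightarrow> 'o) \<Rightarrow> (int \<Rightarrow> 'm) \<Rightarrow> bool" where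
  "totally_acyclic C W X d \<longleftrightarrow> exact_complex C X d \<and> (\<forall>n. X n \<in> W) \<and>
    (\<forall>V\<in>W. \<forall>n.
      exact_seq ([Hom_group C V (X (n - 1)), Hom_group C V (X n), Hom_group C V (X (n + 1))],
        [\<lambda>f. d n \<cdot>\<^bsub>C\<^esub> f, \<lambda>f. d (n + 1) \<cdot>\<^bsub>C\<^esub> f]) \<and>
      exact_seq ([Hom_group C (X (n + 1)) V, Hom_group C (X n) V, Hom_group C (X (n - 1)) V],
        [\<lambda>f. f \<cdot>\<^bsub>C\<^esub> d (n + 1), \<lambda>f. f \<cdot>\<^bsub>C\<^esub> d n]))"

definition Gorenstein :: "('o, 'm, 'z) preadditive_data_scheme \<Rightarrow> 'o set \<Rightarrow> 'o set" where
  "Gorenstein C W = {M. \<exists>X d c. totally_acyclic C W X d \<and>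
    is_cokernel C c (d 1) \<and> isomorphic C M (Cod C c)}"

definition closed_under_direct_summands ::
  "('o, 'm, 'z) preadditive_data_scheme \<Rightarrow> 'o set \<Rightarrow> bool" where
  "closed_under_direct_summands C G \<longleftrightarrow>
    (\<forall>M\<in>G. \<forall>N N' i j p q. is_biproduct C N N' M i j p q \<longrightarrow> N \<in> G)"

end

theory Submission
  imports Defs
begin

text \<open>A totally \<open>\<W>\<close>-acyclic complex is the same thing as a doubly infinite sequence of short exact
  sequences \<open>0 \<rightarrow> Z \<rightarrow> X \<rightarrow> Z' \<rightarrow> 0\<close>, each glued to the next, whose middle terms lie in \<open>\<W>\<close> and which
  stay exact under \<open>Hom(W, -)\<close> and \<open>Hom(-, W)\<close> for every \<open>W\<close> in \<open>\<W>\<close> (\<open>proper_ses\<close>). Cutting the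
  sequence at one object splits it into two independent halves: an object is in \<open>\<G>(\<W>)\<close> iff it has
  an infinite proper coresolution by objects of \<open>\<W>\<close> and, dually, an infinite proper resolution
  (\<open>Gorenstein_iff_coresolved\<close>). The second half is the first one in the opposite category, so it is
  enough to see that retracts inherit proper coresolutions (\<open>coresolved_retract\<close>).

  Let \<open>i : N \<rightarrow> M\<close> have the retraction \<open>r : M \<rightarrow> N\<close>, and let \<open>M \<rightarrow> V \<rightarrow> K\<close> (arrows \<open>m\<close>, \<open>c\<close>) be the first
  step of a coresolution of \<open>M\<close>. The first step for \<open>N\<close> is \<open>N \<rightarrow> V \<rightarrow> L\<close>, where \<open>l : V \<rightarrow> L\<close> is the
  cokernel of \<open>m i\<close>. In general \<open>L\<close> is not a retract of \<open>K\<close>, but it is a retract of \<open>K \<oplus> V\<close>: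
  extending \<open>m i r\<close> along \<open>m\<close> gives \<open>\<phi> : V \<rightarrow> V\<close> with \<open>\<phi> m = m i r\<close>; the cokernel properties of \<open>l\<close>
  and \<open>c\<close> then give \<open>c' : L \<rightarrow> K\<close>, \<open>\<psi> : L \<rightarrow> V\<close> and \<open>\<chi> : K \<rightarrow> L\<close> with \<open>c' l = c\<close>, \<open>\<psi> l = 1 - \<phi>\<close> and
  \<open>\<chi> c = l \<phi>\<close>, and \<open>\<chi> c' + l \<psi> = 1\<close> because both sides agree after composition with \<open>l\<close>. As \<open>K \<oplus> V\<close>
  has a proper coresolution together with \<open>K\<close>, the construction can be repeated with \<open>L\<close> in place of
  \<open>N\<close>; the coinduction runs over all retracts of objects with a proper coresolution.\<close>

section \<open>Arithmetic of arrows\<close>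

context category
begin

lemma Hom_iff: "f \<in> Hom C A B \<longleftrightarrow> f \<in> Arr C \<and> Dom C f = A \<and> Cod C f = B"
  by (simp add: Hom_def)

lemma Comp_simps [simp]:
  assumes "f \<in> Arr C" "g \<in> Arr C" "Dom C g = Cod C f"
  shows "g \<cdot> f \<in> Arr C" "Dom C (g \<cdot> f) = Dom C f" "Cod C (g \<cdot> f) = Cod C g"
  using Comp_in_Hom[of f "Dom C f" "Cod C f" g "Cod C g"] assms by (auto simp: Hom_iff)

lemma Id_simps [simp]:
  assumes "A \<in> Obj C"
  shows "Id C A \<in> Arr C" "Dom C (Id C A) = A" "Cod C (Id C A) = A"
  using Id_in_Hom[OF assms] by (auto simp: Hom_iff)

lemma Comp_Id [simp]:
  assumes "f \<in> Arr C"
  shows "Cod C f = A \<Longrightarrow> Id C A \<cdot> f = f" "Dom C f = A \<Longrightarrow> f \<cdot> Id C A = f"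
  using assms Id_left Id_right by (auto simp: Hom_iff)

lemma Comp_assoc_Arr:
  assumes "f \<in> Arr C" "g \<in> Arr C" "h \<in> Arr C" "Dom C g = Cod C f" "Dom C h = Cod C g"
  shows "(h \<cdot> g) \<cdot> f = h \<cdot> (g \<cdot> f)"
  using Comp_assoc[of f "Dom C f" "Cod C f" g "Cod C g" h "Cod C h"] assms by (auto simp: Hom_iff)

lemma monoD:
  assumes "is_mono C m" "m \<cdot> x = m \<cdot> y" "x \<in> Arr C" "y \<in> Arr C"
    "Cod C x = Dom C m" "Cod C y = Dom C m" "Dom C x = Dom C y"
  shows "x = y"
  using assms unfolding is_mono_def by blast

lemma epiD:
  assumes "is_epi C c" "x \<cdot> c = y \<cdot> c" "x \<in> Arr C" "y \<in> Arr C"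
    "Dom C x = Cod C c" "Dom C y = Cod C c" "Cod C x = Cod C y"
  shows "x = y"
  using assms unfolding is_epi_def by blast

lemma Dom_Obj [simp]: "f \<in> Arr C \<Longrightarrow> Dom C f \<in> Obj C"
  and Cod_Obj [simp]: "f \<in> Arr C \<Longrightarrow> Cod C f \<in> Obj C"
  by (rule Dom_in_Obj Cod_in_Obj, assumption)+

end

context preadditive_category
begin

lemma Null_simps [simp]:
  assumes "A \<in> Obj C" "B \<in> Obj C"
  shows "Null C A B \<in> Arr C" "Dom C (Null C A B) = A" "Cod C (Null C A B) = B"
proof -
  interpret comm_group "Hom_group C A B" by (rule Hom_comm_group[OF assms])
  show "Null C A B \<in> Arr C" "Dom C (Null C A B) = A" "Cod C (Null C A B) = B"
    using one_closed by (auto simp: Hom_group_def Hom_iff)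
qed

context
  fixes f g
  assumes f: "f \<in> Arr C" and g: "g \<in> Arr C" and par: "Dom C g = Dom C f" "Cod C g = Cod C f"
begin

interpretation comm_group "Hom_group C (Dom C f) (Cod C f)"
  by (rule Hom_comm_group) (use f in auto)

lemma Plus_simps [simp]:
  "Plus C f g \<in> Arr C" "Dom C (Plus C f g) = Dom C f" "Cod C (Plus C f g) = Cod C f"
  using m_closed[of f g] f g par by (auto simp: Hom_group_def Hom_iff)

lemma Plus_comm: "Plus C f g = Plus C g f"
  using m_comm[of f g] f g par by (auto simp: Hom_group_def Hom_iff)

lemma Plus_right_cancel:
  assumes "h \<in> Arr C" "Dom C h = Dom C f" "Cod C h = Cod C f" "Plus C f h = Plus C g h"
  shows "f = g"
  using right_cancel[of h f g] f g par assms by (auto simp: Hom_group_def Hom_iff)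

end

lemma Plus_Null [simp]:
  assumes "f \<in> Arr C" "A = Dom C f" "B = Cod C f"
  shows "Plus C f (Null C A B) = f" "Plus C (Null C A B) f = f"
proof -
  interpret comm_group "Hom_group C A B"
    by (rule Hom_comm_group) (use assms in auto)
  show "Plus C f (Null C A B) = f" "Plus C (Null C A B) f = f"
    using r_one[of f] l_one[of f] assms by (auto simp: Hom_group_def Hom_iff)
qed

lemma ex_difference:
  assumes "f \<in> Arr C" "g \<in> Arr C" "Dom C g = Dom C f" "Cod C g = Cod C f"
  obtains h where "h \<in> Arr C" "Dom C h = Dom C f" "Cod C h = Cod C f" "Plus C h g = f"
proof -
  interpret comm_group "Hom_group C (Dom C f) (Cod C f)"
    by (rule Hom_comm_group) (use assms in auto)
  let ?G = "Hom_group C (Dom C f) (Cod C f)"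
  have "f \<in> carrier ?G" "g \<in> carrier ?G"
    using assms by (auto simp: Hom_group_def Hom_iff)
  then have "f \<otimes>\<^bsub>?G\<^esub> inv\<^bsub>?G\<^esub> g \<in> carrier ?G" "(f \<otimes>\<^bsub>?G\<^esub> inv\<^bsub>?G\<^esub> g) \<otimes>\<^bsub>?G\<^esub> g = f"
    by (simp_all add: m_assoc)
  then show thesis
    by (intro that[of "f \<otimes>\<^bsub>?G\<^esub> inv\<^bsub>?G\<^esub> g"]) (auto simp: Hom_group_def Hom_iff)
qed

lemma Comp_Plus:
  assumes "g \<in> Arr C" "g' \<in> Arr C" "Dom C g' = Dom C g" "Cod C g' = Cod C g" "f \<in> Arr C"
  shows "Cod C f = Dom C g \<Longrightarrow> Plus C g g' \<cdot> f = Plus C (g \<cdot> f) (g' \<cdot> f)"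
    and "Dom C f = Cod C g \<Longrightarrow> f \<cdot> Plus C g g' = Plus C (f \<cdot> g) (f \<cdot> g')"
  using Comp_Plus_left[of f "Dom C f" "Dom C g" g "Cod C g" g']
    Comp_Plus_right[of g "Dom C g" "Cod C g" g' f "Cod C f"] assms
  by (auto simp: Hom_iff)

lemma Comp_Null [simp]:
  assumes "f \<in> Arr C" "A \<in> Obj C"
  shows "B = Dom C f \<Longrightarrow> f \<cdot> Null C A B = Null C A (Cod C f)"
    and "B = Cod C f \<Longrightarrow> Null C B A \<cdot> f = Null C (Dom C f) A"
proof -
  assume B: "B = Dom C f"
  have "f \<cdot> Plus C (Null C A B) (Null C A B) = Plus C (f \<cdot> Null C A B) (f \<cdot> Null C A B)"
    by (rule Comp_Plus) (use assms B in auto)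
  then have "Plus C (f \<cdot> Null C A B) (f \<cdot> Null C A B)
      = Plus C (Null C A (Cod C f)) (f \<cdot> Null C A B)"
    using assms B by simp
  from Plus_right_cancel[OF _ _ _ _ _ _ _ this] assms B
  show "f \<cdot> Null C A B = Null C A (Cod C f)" by simp
next
  assume B: "B = Cod C f"
  have "Plus C (Null C B A) (Null C B A) \<cdot> f = Plus C (Null C B A \<cdot> f) (Null C B A \<cdot> f)"
    by (rule Comp_Plus) (use assms B in auto)
  then have "Plus C (Null C B A \<cdot> f) (Null C B A \<cdot> f)
      = Plus C (Null C (Dom C f) A) (Null C B A \<cdot> f)"
    using assms B by simp
  from Plus_right_cancel[OF _ _ _ _ _ _ _ this] assms B
  show "Null C B A \<cdot> f = Null C (Dom C f) A" by simp
qed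

end


section \<open>Duality\<close>

definition opposite ::
  "('o, 'm, 'z) preadditive_data_scheme \<Rightarrow> ('o, 'm, 'z) preadditive_data_scheme" where
  "opposite C = C\<lparr>Dom := Cod C, Cod := Dom C, Comp := \<lambda>g f. Comp C f g, Null := \<lambda>A B. Null C B A\<rparr>"

lemma opposite_simps [simp]:
  "Obj (opposite C) = Obj C" "Arr (opposite C) = Arr C"
  "Dom (opposite C) = Cod C" "Cod (opposite C) = Dom C"
  "Id (opposite C) = Id C" "Comp (opposite C) g f = Comp C f g"
  "Plus (opposite C) = Plus C" "Null (opposite C) A B = Null C B A"
  "Hom (opposite C) A B = Hom C B A"
  by (auto simp: opposite_def Hom_def)

lemma Hom_group_opposite [simp]: "Hom_group (opposite C) A B = Hom_group C B A"
  by (simp add: Hom_group_def)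

lemma opposite_dual [simp]:
  "is_mono (opposite C) f \<longleftrightarrow> is_epi C f"
  "is_epi (opposite C) f \<longleftrightarrow> is_mono C f"
  "is_kernel (opposite C) k f \<longleftrightarrow> is_cokernel C k f"
  "is_cokernel (opposite C) k f \<longleftrightarrow> is_kernel C k f"
  "is_biproduct (opposite C) A B S i j p q \<longleftrightarrow> is_biproduct C A B S p q i j"
  by (auto simp: is_mono_def is_epi_def is_kernel_def is_cokernel_def is_biproduct_def)

lemma zero_object_opposite [simp]: "zero_object (opposite C) Z \<longleftrightarrow> zero_object C Z"
  unfolding zero_object_def by auto

lemma isomorphic_opposite [simp]: "isomorphic (opposite C) A B \<longleftrightarrow> isomorphic C A B"
  unfolding isomorphic_def by auto

lemma (in preadditive_category) preadditive_category_opposite: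
  "preadditive_category (opposite C)"
proof (intro preadditive_category.intro category.intro preadditive_category_axioms.intro)
  fix f g h A B D E
  assume "f \<in> Hom (opposite C) A B" "g \<in> Hom (opposite C) B D" "h \<in> Hom (opposite C) D E"
  then show "Comp (opposite C) (Comp (opposite C) h g) f
      = Comp (opposite C) h (Comp (opposite C) g f)"
    using Comp_assoc[of h E D g B f A] by simp
qed (auto simp: Id_in_Hom Comp_in_Hom Id_left Id_right Hom_comm_group
    Comp_Plus_left Comp_Plus_right)

lemma (in abelian_category) abelian_category_opposite: "abelian_category (opposite C)"
proof -
  interpret op: preadditive_category "opposite C" by (rule preadditive_category_opposite)
  show ?thesis
  proof
    fix A B assume "A \<in> Obj (opposite C)" "B \<in> Obj (opposite C)"
    then obtain S i j p q where "is_biproduct C A B S i j p q"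
      using ex_biproduct[of A B] by auto
    then have "is_biproduct (opposite C) A B S p q i j" by simp
    then show "\<exists>S i j p q. is_biproduct (opposite C) A B S i j p q" by blast
  qed (simp_all add: ex_zero_object ex_kernel ex_cokernel mono_is_kernel epi_is_cokernel)
qed

lemma full_additive_subcategory_opposite:
  assumes "full_additive_subcategory C W"
  shows "full_additive_subcategory (opposite C) W"
  using assms unfolding full_additive_subcategory_def opposite_dual opposite_simps
    zero_object_opposite isomorphic_opposite by blast


section \<open>Kernels and cokernels\<close>

context preadditive_category
begin

lemma kernelD:
  assumes "is_kernel C k f"
  shows "k \<in> Arr C" "f \<in> Arr C" "Cod C k = Dom C f" "f \<cdot> k = Null C (Dom C k) (Cod C f)"
  using assms unfolding is_kernel_def by auto

lemma cokernelD:
  assumes "is_cokernel C c f"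
  shows "c \<in> Arr C" "f \<in> Arr C" "Dom C c = Cod C f" "c \<cdot> f = Null C (Dom C f) (Cod C c)"
  using assms unfolding is_cokernel_def by auto

lemma kernel_factor:
  assumes "is_kernel C k f" "h \<in> Arr C" "Cod C h = Dom C f" "f \<cdot> h = Null C (Dom C h) (Cod C f)"
  obtains u where "u \<in> Arr C" "Dom C u = Dom C h" "Cod C u = Dom C k" "k \<cdot> u = h"
proof -
  have "\<exists>!u. u \<in> Hom C (Dom C h) (Dom C k) \<and> k \<cdot> u = h"
    using assms unfolding is_kernel_def by blast
  then show thesis using that by (auto simp: Hom_iff)
qed

lemma cokernel_factor:
  assumes "is_cokernel C c f" "h \<in> Arr C" "Dom C h = Cod C f" "h \<cdot> f = Null C (Dom C f) (Cod C h)"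
  obtains u where "u \<in> Arr C" "Dom C u = Cod C c" "Cod C u = Cod C h" "u \<cdot> c = h"
  by (rule preadditive_category.kernel_factor[OF preadditive_category_opposite, of c f h])
    (use assms that in simp_all)

lemma kernelI:
  assumes "k \<in> Arr C" "f \<in> Arr C" "Cod C k = Dom C f" "f \<cdot> k = Null C (Dom C k) (Cod C f)"
    and "is_mono C k"
    and "\<And>h. \<lbrakk>h \<in> Arr C; Cod C h = Dom C f; f \<cdot> h = Null C (Dom C h) (Cod C f)\<rbrakk>
      \<Longrightarrow> \<exists>u\<in>Arr C. Dom C u = Dom C h \<and> Cod C u = Dom C k \<and> k \<cdot> u = h"
  shows "is_kernel C k f"
  unfolding is_kernel_def Hom_iff using assms(1-4)
proof (intro conjI ballI impI)
  fix h assume h: "h \<in> Arr C" "Cod C h = Dom C f \<and> f \<cdot> h = Null C (Dom C h) (Cod C f)"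
  then obtain u where "u \<in> Arr C" "Dom C u = Dom C h" "Cod C u = Dom C k" "k \<cdot> u = h"
    using assms(6) by blast
  then show "\<exists>!u. (u \<in> Arr C \<and> Dom C u = Dom C h \<and> Cod C u = Dom C k) \<and> k \<cdot> u = h"
    using monoD[OF \<open>is_mono C k\<close>] by (intro ex1I[of _ u]) auto
qed

lemma cokernelI:
  assumes "c \<in> Arr C" "f \<in> Arr C" "Dom C c = Cod C f" "c \<cdot> f = Null C (Dom C f) (Cod C c)"
    and "is_epi C c"
    and "\<And>h. \<lbrakk>h \<in> Arr C; Dom C h = Cod C f; h \<cdot> f = Null C (Dom C f) (Cod C h)\<rbrakk>
      \<Longrightarrow> \<exists>u\<in>Arr C. Cod C u = Cod C h \<and> Dom C u = Cod C c \<and> u \<cdot> c = h"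
  shows "is_cokernel C c f"
  using preadditive_category.kernelI[OF preadditive_category_opposite, of c f] assms by simp

lemma kernel_is_mono:
  assumes "is_kernel C k f"
  shows "is_mono C k"
  unfolding is_mono_def
proof (intro conjI ballI impI)
  note k = kernelD[OF assms]
  show "k \<in> Arr C" by (rule k)
  fix x y assume xy: "x \<in> Arr C" "y \<in> Arr C"
    "Cod C x = Dom C k \<and> Cod C y = Dom C k \<and> Dom C x = Dom C y \<and> k \<cdot> x = k \<cdot> y"
  have "f \<cdot> (k \<cdot> x) = Null C (Dom C (k \<cdot> x)) (Cod C f)"
    using k xy by (simp flip: Comp_assoc_Arr)
  with k xy assms have "\<exists>!u. u \<in> Hom C (Dom C (k \<cdot> x)) (Dom C k) \<and> k \<cdot> u = k \<cdot> x"
    unfolding is_kernel_def by (metis Comp_simps(1) Comp_simps(3))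
  with k xy show "x = y" by (auto simp: Hom_iff)
qed

lemma cokernel_is_epi:
  assumes "is_cokernel C c f"
  shows "is_epi C c"
  using preadditive_category.kernel_is_mono[OF preadditive_category_opposite, of c f] assms by simp

lemma mono_if_zero_kernel:
  assumes "m \<in> Arr C"
    and "\<And>x. \<lbrakk>x \<in> Arr C; Cod C x = Dom C m; m \<cdot> x = Null C (Dom C x) (Cod C m)\<rbrakk>
      \<Longrightarrow> x = Null C (Dom C x) (Dom C m)"
  shows "is_mono C m"
  unfolding is_mono_def
proof (intro conjI ballI impI)
  fix x y assume xy: "x \<in> Arr C" "y \<in> Arr C"
    "Cod C x = Dom C m \<and> Cod C y = Dom C m \<and> Dom C x = Dom C y \<and> m \<cdot> x = m \<cdot> y"
  then obtain z where z: "z \<in> Arr C" "Dom C z = Dom C x" "Cod C z = Cod C x" "Plus C z y = x"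
    using ex_difference[of x y] by metis
  have "Plus C (m \<cdot> z) (m \<cdot> y) = m \<cdot> Plus C z y"
    by (rule Comp_Plus(2)[symmetric]) (use assms(1) xy z(1-3) in auto)
  also have "\<dots> = Plus C (Null C (Dom C x) (Cod C m)) (m \<cdot> y)"
    using assms(1) xy z by simp
  finally have "m \<cdot> z = Null C (Dom C x) (Cod C m)"
    by (rule Plus_right_cancel[rotated -1]) (use assms(1) xy z in auto)
  then have "m \<cdot> z = Null C (Dom C z) (Cod C m)" using z(2) by simp
  from assms(2)[OF z(1) _ this] have "z = Null C (Dom C y) (Cod C y)" using z(2,3) xy by simp
  with z(4) xy(2) show "x = y" by simp
qed (rule assms)

text \<open>If \<open>k\<close> is the kernel of \<open>g\<close>, then \<open>g\<close> factors through the cokernel of \<open>k\<close>, so everything that this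
  cokernel annihilates is annihilated by \<open>g\<close>.\<close>

lemma kernel_of_cokernel:
  assumes "is_kernel C k g" "is_cokernel C c k"
  shows "is_kernel C k c"
proof (rule kernelI)
  note k = kernelD[OF assms(1)] and c = cokernelD[OF assms(2)]
  show "k \<in> Arr C" "c \<in> Arr C" "Cod C k = Dom C c" "c \<cdot> k = Null C (Dom C k) (Cod C c)"
    using c by auto
  show "is_mono C k" by (rule kernel_is_mono[OF assms(1)])
  fix h assume h: "h \<in> Arr C" "Cod C h = Dom C c" "c \<cdot> h = Null C (Dom C h) (Cod C c)"
  obtain u where u: "u \<in> Arr C" "Dom C u = Cod C c" "Cod C u = Cod C g" "u \<cdot> c = g"
    using cokernel_factor[OF assms(2), of g] k by metis
  have "g \<cdot> h = u \<cdot> (c \<cdot> h)"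
    unfolding u(4)[symmetric] by (rule Comp_assoc_Arr) (use u c h in auto)
  then have "g \<cdot> h = Null C (Dom C h) (Cod C g)" using u h by simp
  then show "\<exists>u\<in>Arr C. Dom C u = Dom C h \<and> Cod C u = Dom C k \<and> k \<cdot> u = h"
    using kernel_factor[OF assms(1), of h] h k c by metis
qed

lemma cokernel_of_kernel:
  assumes "is_cokernel C c g" "is_kernel C k c"
  shows "is_cokernel C c k"
  using preadditive_category.kernel_of_cokernel[OF preadditive_category_opposite, of c g k] assms
  by simp

lemma kernel_mono_Comp:
  assumes "is_kernel C k c" "is_mono C m" "Dom C m = Cod C c"
  shows "is_kernel C k (m \<cdot> c)"
proof (rule kernelI)
  note k = kernelD[OF assms(1)]
  have m: "m \<in> Arr C" using assms(2) by (simp add: is_mono_def)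
  show "k \<in> Arr C" "m \<cdot> c \<in> Arr C" "Cod C k = Dom C (m \<cdot> c)" using k m assms by auto
  show "(m \<cdot> c) \<cdot> k = Null C (Dom C k) (Cod C (m \<cdot> c))"
    using k m assms by (simp add: Comp_assoc_Arr)
  show "is_mono C k" by (rule kernel_is_mono[OF assms(1)])
  fix h assume h: "h \<in> Arr C" "Cod C h = Dom C (m \<cdot> c)"
    "(m \<cdot> c) \<cdot> h = Null C (Dom C h) (Cod C (m \<cdot> c))"
  have "m \<cdot> (c \<cdot> h) = m \<cdot> Null C (Dom C h) (Cod C c)"
    using h k m assms by (simp add: Comp_assoc_Arr)
  then have "c \<cdot> h = Null C (Dom C h) (Cod C c)"
    by (rule monoD[OF assms(2)]) (use h k m assms in auto)
  then show "\<exists>u\<in>Arr C. Dom C u = Dom C h \<and> Cod C u = Dom C k \<and> k \<cdot> u = h"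
    using kernel_factor[OF assms(1), of h] h k m assms by (metis Comp_simps(2))
qed

lemma cokernel_Comp_epi:
  assumes "is_epi C e" "Cod C e = Dom C m" "m \<in> Arr C"
  shows "is_cokernel C c (m \<cdot> e) \<longleftrightarrow> is_cokernel C c m"
proof -
  have e: "e \<in> Arr C" using assms(1) by (simp add: is_epi_def)
  have "h \<cdot> (m \<cdot> e) = Null C (Dom C e) (Cod C h) \<longleftrightarrow> h \<cdot> m = Null C (Dom C m) (Cod C h)"
    if h: "h \<in> Arr C" "Dom C h = Cod C m" for h
  proof
    assume "h \<cdot> (m \<cdot> e) = Null C (Dom C e) (Cod C h)"
    then have "(h \<cdot> m) \<cdot> e = Null C (Dom C m) (Cod C h) \<cdot> e"
      using h e assms by (simp add: Comp_assoc_Arr)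
    then show "h \<cdot> m = Null C (Dom C m) (Cod C h)"
      by (rule epiD[OF assms(1)]) (use h e assms in auto)
  next
    assume "h \<cdot> m = Null C (Dom C m) (Cod C h)"
    then show "h \<cdot> (m \<cdot> e) = Null C (Dom C e) (Cod C h)"
      using h e assms by (simp flip: Comp_assoc_Arr)
  qed
  then show ?thesis
    unfolding is_cokernel_def using e assms by (simp cong: conj_cong)
qed

end

context abelian_category
begin

text \<open>The arrow from the coimage of \<open>f\<close> to its target is mono. If \<open>m x = 0\<close>, then \<open>m\<close> factors through the
  cokernel \<open>q\<close> of \<open>x\<close>. The epi \<open>q c\<close> is the cokernel of some \<open>h\<close>, which \<open>f\<close> annihilates; hence \<open>h\<close>
  factors through the kernel of \<open>f\<close> and \<open>c h = 0\<close>. So \<open>c\<close> factors through \<open>q c\<close>, which makes \<open>q\<close> a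
  split mono, and \<open>q x = 0\<close> forces \<open>x = 0\<close>.\<close>

lemma coimage_mono:
  assumes "is_cokernel C c k" "is_kernel C k f"
    and "m \<in> Arr C" "Dom C m = Cod C c" "m \<cdot> c = f"
  shows "is_mono C m"
proof (rule mono_if_zero_kernel)
  note c = cokernelD[OF assms(1)] and k = kernelD[OF assms(2)]
  have epi_c: "is_epi C c" by (rule cokernel_is_epi[OF assms(1)])
  fix x assume x: "x \<in> Arr C" "Cod C x = Dom C m" "m \<cdot> x = Null C (Dom C x) (Cod C m)"
  obtain q where q: "is_cokernel C q x" using ex_cokernel x by blast
  note qD = cokernelD[OF q]
  obtain m' where m': "m' \<in> Arr C" "Dom C m' = Cod C q" "Cod C m' = Cod C m" "m' \<cdot> q = m"
    by (rule cokernel_factor[OF q, of m]) (use x assms in auto)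
  have "is_epi C (q \<cdot> c)"
    unfolding is_epi_def
  proof (intro conjI ballI impI)
    show "q \<cdot> c \<in> Arr C" using c qD x assms by simp
    fix a b assume ab: "a \<in> Arr C" "b \<in> Arr C"
      "Dom C a = Cod C (q \<cdot> c) \<and> Dom C b = Cod C (q \<cdot> c) \<and> Cod C a = Cod C b \<and>
       a \<cdot> (q \<cdot> c) = b \<cdot> (q \<cdot> c)"
    then have "(a \<cdot> q) \<cdot> c = (b \<cdot> q) \<cdot> c" using c qD x assms by (simp add: Comp_assoc_Arr)
    then have "a \<cdot> q = b \<cdot> q"
      by (rule epiD[OF epi_c]) (use ab c qD x assms in auto)
    then show "a = b"
      by (rule epiD[OF cokernel_is_epi[OF q]]) (use ab c qD x assms in auto)
  qed
  then obtain h where h: "is_cokernel C (q \<cdot> c) h" using epi_is_cokernel by blast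
  note hD = cokernelD[OF h]
  have [simp]: "Dom C (q \<cdot> c) = Dom C c" "Cod C (q \<cdot> c) = Cod C q"
    using c qD x assms by simp_all
  have f: "f = m' \<cdot> (q \<cdot> c)" using m' qD c x assms by (simp flip: Comp_assoc_Arr)
  have "f \<cdot> h = m' \<cdot> ((q \<cdot> c) \<cdot> h)"
    unfolding f using m' qD c x assms hD by (subst Comp_assoc_Arr) auto
  then have fh: "f \<cdot> h = Null C (Dom C h) (Cod C f)"
    using hD m' assms c by auto
  obtain y where y: "y \<in> Arr C" "Dom C y = Dom C h" "Cod C y = Dom C k" "k \<cdot> y = h"
    by (rule kernel_factor[OF assms(2), of h]) (use hD c k fh in auto)
  have "c \<cdot> h = (c \<cdot> k) \<cdot> y"
    unfolding y(4)[symmetric] by (rule Comp_assoc_Arr[symmetric]) (use y c k in auto)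
  then have ch: "c \<cdot> h = Null C (Dom C h) (Cod C c)" using c y by simp
  obtain t where t: "t \<in> Arr C" "Dom C t = Cod C q" "Cod C t = Cod C c" "t \<cdot> (q \<cdot> c) = c"
    by (rule cokernel_factor[OF h, of c]) (use hD c ch in auto)
  have "(t \<cdot> q) \<cdot> c = Id C (Cod C c) \<cdot> c" using t qD x assms c by (simp add: Comp_assoc_Arr)
  then have "t \<cdot> q = Id C (Cod C c)"
    by (rule epiD[OF epi_c]) (use t qD x assms c in auto)
  then have "x = (t \<cdot> q) \<cdot> x" using x assms by simp
  also have "\<dots> = t \<cdot> (q \<cdot> x)" using t qD x by (simp add: Comp_assoc_Arr)
  also have "\<dots> = Null C (Dom C x) (Dom C m)" using qD t x assms by simp
  finally show "x = Null C (Dom C x) (Dom C m)" .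
qed (rule assms(3))

lemma mono_is_kernel_of_cokernel:
  assumes "is_mono C m" "is_cokernel C c m"
  shows "is_kernel C m c"
proof -
  obtain g where "is_kernel C m g" using mono_is_kernel[OF assms(1)] by blast
  from kernel_of_cokernel[OF this assms(2)] show ?thesis .
qed

end


section \<open>Biproducts\<close>

context category
begin

text \<open>Composites are normalised by bracketing to the right, which hides a redex \<open>g \<cdot> f\<close> inside
  \<open>g \<cdot> (f \<cdot> x)\<close>. This form turns an equation for \<open>g \<cdot> f\<close> into a rewrite rule for the hidden redex.\<close>

lemma Comp_Comp_eq:
  assumes "g \<cdot> f = h" "f \<in> Arr C" "g \<in> Arr C" "Dom C g = Cod C f" "x \<in> Arr C" "Cod C x = Dom C f"
  shows "g \<cdot> (f \<cdot> x) = h \<cdot> x"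
  unfolding assms(1)[symmetric] by (rule Comp_assoc_Arr[symmetric]) (use assms(2-) in auto)

end

context preadditive_category
begin

lemma biproductD:
  assumes "is_biproduct C A B S i j p q"
  shows "A \<in> Obj C" "B \<in> Obj C" "S \<in> Obj C"
    "i \<in> Arr C" "Dom C i = A" "Cod C i = S" "j \<in> Arr C" "Dom C j = B" "Cod C j = S"
    "p \<in> Arr C" "Dom C p = S" "Cod C p = A" "q \<in> Arr C" "Dom C q = S" "Cod C q = B"
    "p \<cdot> i = Id C A" "q \<cdot> j = Id C B" "q \<cdot> i = Null C A B" "p \<cdot> j = Null C B A"
    "Plus C (i \<cdot> p) (j \<cdot> q) = Id C S"
  using assms unfolding is_biproduct_def Hom_iff by auto

lemma biproduct_decomp:
  assumes "is_biproduct C A B S i j p q" "x \<in> Arr C" "Cod C x = S"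
  shows "Plus C (i \<cdot> (p \<cdot> x)) (j \<cdot> (q \<cdot> x)) = x"
proof -
  note b = biproductD[OF assms(1)]
  have "Plus C (i \<cdot> p) (j \<cdot> q) \<cdot> x = Plus C ((i \<cdot> p) \<cdot> x) ((j \<cdot> q) \<cdot> x)"
    by (rule Comp_Plus) (use b(1-15) assms(2,3) in auto)
  then show ?thesis using b assms(2,3) by (simp add: Comp_assoc_Arr)
qed

lemma biproduct_pair:
  assumes "is_biproduct C A B S i j p q" "a \<in> Hom C T A" "b \<in> Hom C T B"
  obtains w where "w \<in> Arr C" "Dom C w = T" "Cod C w = S" "p \<cdot> w = a" "q \<cdot> w = b"
proof
  note d = biproductD[OF assms(1)]
  have ab: "a \<in> Arr C" "Dom C a = T" "Cod C a = A" "b \<in> Arr C" "Dom C b = T" "Cod C b = B"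
    using assms by (auto simp: Hom_iff)
  let ?w = "Plus C (i \<cdot> a) (j \<cdot> b)"
  show w: "?w \<in> Arr C" "Dom C ?w = T" "Cod C ?w = S"
    using d(1-15) ab by simp_all
  have T: "T \<in> Obj C" using ab(1,2) by auto
  have "p \<cdot> ?w = Plus C (p \<cdot> (i \<cdot> a)) (p \<cdot> (j \<cdot> b))"
    by (rule Comp_Plus) (use d(1-15) ab in auto)
  then show "p \<cdot> ?w = a"
    using d(1-15) ab T by (simp add: Comp_Comp_eq[OF d(16)] Comp_Comp_eq[OF d(19)])
  have "q \<cdot> ?w = Plus C (q \<cdot> (i \<cdot> a)) (q \<cdot> (j \<cdot> b))"
    by (rule Comp_Plus) (use d(1-15) ab in auto)
  then show "q \<cdot> ?w = b"
    using d(1-15) ab T by (simp add: Comp_Comp_eq[OF d(17)] Comp_Comp_eq[OF d(18)])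
qed

lemma biproduct_ext:
  assumes "is_biproduct C A B S i j p q" "x \<in> Arr C" "y \<in> Arr C" "Cod C x = S" "Cod C y = S"
    "p \<cdot> x = p \<cdot> y" "q \<cdot> x = q \<cdot> y"
  shows "x = y"
  using biproduct_decomp[OF assms(1), of x] biproduct_decomp[OF assms(1), of y] assms(2-)
  by metis

lemma biproduct_copair:
  assumes "is_biproduct C A B S i j p q" "a \<in> Hom C A T" "b \<in> Hom C B T"
  obtains w where "w \<in> Arr C" "Dom C w = S" "Cod C w = T" "w \<cdot> i = a" "w \<cdot> j = b"
  using preadditive_category.biproduct_pair[OF preadditive_category_opposite, of A B S p q i j a T b]
    assms by auto

lemma biproduct_coext:
  assumes "is_biproduct C A B S i j p q" "x \<in> Arr C" "y \<in> Arr C" "Dom C x = S" "Dom C y = S"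
    "x \<cdot> i = y \<cdot> i" "x \<cdot> j = y \<cdot> j"
  shows "x = y"
  by (rule preadditive_category.biproduct_ext[OF preadditive_category_opposite, of A B S p q i j])
    (use assms in auto)

end


section \<open>Proper coresolutions\<close>

text \<open>A short exact sequence with middle term in \<open>W\<close> that the functors \<open>Hom(-, U)\<close> and \<open>Hom(U, -)\<close> with
  \<open>U\<close> in \<open>W\<close> keep exact. These functors are left exact anyway, so only surjectivity at the end is
  required, as an extension and a lifting property. The notion is self-dual.\<close>

definition proper_ses :: "('o, 'm, 'z) preadditive_data_scheme \<Rightarrow> 'o set \<Rightarrow> 'm \<Rightarrow> 'm \<Rightarrow> bool" where
  "proper_ses C W m c \<longleftrightarrow> is_kernel C m c \<and> is_cokernel C c m \<and> Dom C c \<in> W \<and>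
    (\<forall>U\<in>W. \<forall>g\<in>Hom C (Dom C m) U. \<exists>h\<in>Hom C (Dom C c) U. h \<cdot>\<^bsub>C\<^esub> m = g) \<and>
    (\<forall>U\<in>W. \<forall>g\<in>Hom C U (Cod C c). \<exists>h\<in>Hom C U (Dom C c). c \<cdot>\<^bsub>C\<^esub> h = g)"

lemma proper_ses_opposite [simp]: "proper_ses (opposite C) W c m \<longleftrightarrow> proper_ses C W m c"
proof (cases "is_kernel C m c")
  case True
  then have [simp]: "Cod C m = Dom C c" by (simp add: is_kernel_def)
  show ?thesis
    unfolding proper_ses_def by (simp only: opposite_dual opposite_simps \<open>Cod C m = Dom C c\<close> conj_ac)
qed (simp add: proper_ses_def)

text \<open>Being the start of an infinite exact sequence \<open>0 \<rightarrow> M \<rightarrow> V\<^sub>0 \<rightarrow> V\<^sub>1 \<rightarrow> \<dots>\<close> obtained by splicing proper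
  short exact sequences.\<close>

coinductive coresolved :: "('o, 'm, 'z) preadditive_data_scheme \<Rightarrow> 'o set \<Rightarrow> 'o \<Rightarrow> bool"
  for C W where
  "\<lbrakk>proper_ses C W m c; coresolved C W (Cod C c)\<rbrakk> \<Longrightarrow> coresolved C W (Dom C m)"

definition retract :: "('o, 'm, 'z) category_data_scheme \<Rightarrow> 'o \<Rightarrow> 'o \<Rightarrow> bool" where
  "retract C N M \<longleftrightarrow> N \<in> Obj C \<and> M \<in> Obj C \<and>
    (\<exists>i\<in>Hom C N M. \<exists>r\<in>Hom C M N. r \<cdot>\<^bsub>C\<^esub> i = Id C N)"

lemma retract_opposite [simp]: "retract (opposite C) N M \<longleftrightarrow> retract C N M"
  unfolding retract_def by auto

context preadditive_category
begin

lemma proper_sesE: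
  assumes "proper_ses C W m c"
  obtains M X L where "X \<in> W" "M \<in> Obj C" "X \<in> Obj C" "L \<in> Obj C"
    "m \<in> Arr C" "Dom C m = M" "Cod C m = X" "c \<in> Arr C" "Dom C c = X" "Cod C c = L"
    "c \<cdot> m = Null C M L" "is_kernel C m c" "is_cokernel C c m" "is_mono C m" "is_epi C c"
proof -
  have k: "is_kernel C m c" and c: "is_cokernel C c m" and W: "Dom C c \<in> W"
    using assms by (auto simp: proper_ses_def)
  show thesis
    by (rule that[of "Dom C c" "Dom C m" "Cod C c"])
      (use W kernelD[OF k] k c kernel_is_mono[OF k] cokernel_is_epi[OF c] in auto)
qed

lemma proper_ses_extend:
  assumes "proper_ses C W m c" "g \<in> Arr C" "Dom C g = Dom C m" "Cod C g \<in> W"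
  obtains h where "h \<in> Arr C" "Dom C h = Dom C c" "Cod C h = Cod C g" "h \<cdot> m = g"
proof -
  have ext: "\<forall>U\<in>W. \<forall>g\<in>Hom C (Dom C m) U. \<exists>h\<in>Hom C (Dom C c) U. h \<cdot> m = g"
    using assms(1) unfolding proper_ses_def by (elim conjE)
  have "g \<in> Hom C (Dom C m) (Cod C g)" using assms by (simp add: Hom_iff)
  from bspec[OF bspec[OF ext assms(4)] this] show thesis
    using that by (auto simp: Hom_iff)
qed

lemma proper_ses_lift:
  assumes "proper_ses C W m c" "g \<in> Arr C" "Cod C g = Cod C c" "Dom C g \<in> W"
  obtains h where "h \<in> Arr C" "Dom C h = Dom C g" "Cod C h = Dom C c" "c \<cdot> h = g"
proof -
  have lift: "\<forall>U\<in>W. \<forall>g\<in>Hom C U (Cod C c). \<exists>h\<in>Hom C U (Dom C c). c \<cdot> h = g"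
    using assms(1) unfolding proper_ses_def by (elim conjE)
  have "g \<in> Hom C (Dom C g) (Cod C c)" using assms by (simp add: Hom_iff)
  from bspec[OF bspec[OF lift assms(4)] this] show thesis
    using that by (auto simp: Hom_iff)
qed

lemma proper_sesI:
  assumes "is_kernel C m c" "is_cokernel C c m" "Dom C c \<in> W"
    and "\<And>g. \<lbrakk>g \<in> Arr C; Dom C g = Dom C m; Cod C g \<in> W\<rbrakk>
      \<Longrightarrow> \<exists>h\<in>Arr C. Dom C h = Dom C c \<and> Cod C h = Cod C g \<and> h \<cdot> m = g"
    and "\<And>g. \<lbrakk>g \<in> Arr C; Cod C g = Cod C c; Dom C g \<in> W\<rbrakk>
      \<Longrightarrow> \<exists>h\<in>Arr C. Dom C h = Dom C g \<and> Cod C h = Dom C c \<and> c \<cdot> h = g"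
  shows "proper_ses C W m c"
  unfolding proper_ses_def
proof (intro conjI ballI)
  fix U g assume "U \<in> W" "g \<in> Hom C (Dom C m) U"
  with assms(4)[of g] show "\<exists>h\<in>Hom C (Dom C c) U. h \<cdot> m = g" by (auto simp: Hom_iff)
next
  fix U g assume "U \<in> W" "g \<in> Hom C U (Cod C c)"
  with assms(5)[of g] show "\<exists>h\<in>Hom C U (Dom C c). c \<cdot> h = g" by (auto simp: Hom_iff)
qed (rule assms)+

text \<open>Only the first step of a coresolution \<open>M \<rightarrow> X \<rightarrow> L\<close> has to be changed: it is replaced by
  \<open>M \<oplus> V \<rightarrow> X \<oplus> V \<rightarrow> L\<close>, with the identity of \<open>V\<close> as the second component of the first arrow.\<close>

lemma coresolved_biproduct:
  assumes W: "full_additive_subcategory C W"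
    and M: "coresolved C W M" and V: "V \<in> W" and S: "is_biproduct C M V S i j p q"
  shows "coresolved C W S"
proof -
  obtain m c where mc: "proper_ses C W m c" "Dom C m = M" "coresolved C W (Cod C c)"
    using M by (cases rule: coresolved.cases) auto
  obtain X L where X: "X \<in> W" "X \<in> Obj C" and L: "L \<in> Obj C" "Cod C c = L"
    and m: "m \<in> Arr C" "Cod C m = X" and c: "c \<in> Arr C" "Dom C c = X"
    and cm: "c \<cdot> m = Null C M L"
    and exact: "is_kernel C m c" "is_cokernel C c m" "is_mono C m" "is_epi C c"
    using proper_sesE[OF mc(1)] mc(2) by metis
  obtain T i' j' p' q' where T: "T \<in> W" "is_biproduct C X V T i' j' p' q'"
    using W X V unfolding full_additive_subcategory_def by blast
  note ty = X(2) L m mc(2) c biproductD(1-15)[OF S] biproductD(1-15)[OF T(2)]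
  note S_eq = biproductD(16-19)[OF S] and T_eq = biproductD(16-19)[OF T(2)]
  have "m \<cdot> p \<in> Hom C S X" "q \<in> Hom C S V" using ty by (simp_all add: Hom_iff)
  then obtain m' where m': "m' \<in> Arr C" "Dom C m' = S" "Cod C m' = T" "p' \<cdot> m' = m \<cdot> p" "q' \<cdot> m' = q"
    using biproduct_pair[OF T(2)] by metis
  define c' where "c' = c \<cdot> p'"
  have c': "c' \<in> Arr C" "Dom C c' = T" "Cod C c' = L" using ty by (simp_all add: c'_def)
  note assoc = Comp_assoc_Arr Comp_Comp_eq[OF cm] S_eq[THEN Comp_Comp_eq] T_eq[THEN Comp_Comp_eq]
    Comp_Comp_eq[OF m'(4)] Comp_Comp_eq[OF m'(5)]
  have mi: "m' \<cdot> i = i' \<cdot> m"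
    by (rule biproduct_ext[OF T(2)]) (use ty m' in \<open>simp_all add: assoc S_eq\<close>)
  have mj: "m' \<cdot> j = j'"
    by (rule biproduct_ext[OF T(2)]) (use ty m' in \<open>simp_all add: assoc S_eq T_eq\<close>)
  have ci: "c' \<cdot> i' = c" and cj: "c' \<cdot> j' = Null C V L"
    using ty by (simp_all add: c'_def assoc T_eq)
  have cm': "c' \<cdot> m' = Null C S L"
    using ty m' by (simp add: c'_def assoc cm)
  note assoc = assoc mi[THEN Comp_Comp_eq] mj[THEN Comp_Comp_eq] ci[THEN Comp_Comp_eq]
    cj[THEN Comp_Comp_eq]
  \<comment> \<open>Both components of \<open>m'\<close>, namely \<open>m\<close> and the identity of \<open>V\<close>, are mono.\<close>
  have mono: "is_mono C m'"
    unfolding is_mono_def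
  proof (intro conjI ballI impI)
    fix x y assume xy: "x \<in> Arr C" "y \<in> Arr C"
      "Cod C x = Dom C m' \<and> Cod C y = Dom C m' \<and> Dom C x = Dom C y \<and> m' \<cdot> x = m' \<cdot> y"
    have "m \<cdot> (p \<cdot> x) = p' \<cdot> (m' \<cdot> x)" "q \<cdot> x = q' \<cdot> (m' \<cdot> x)"
      "m \<cdot> (p \<cdot> y) = p' \<cdot> (m' \<cdot> y)" "q \<cdot> y = q' \<cdot> (m' \<cdot> y)"
      using ty m' xy(1,2) conjunct1[OF xy(3)] conjunct1[OF conjunct2[OF xy(3)]]
      by (simp_all add: assoc)
    then have mp: "m \<cdot> (p \<cdot> x) = m \<cdot> (p \<cdot> y)" and q: "q \<cdot> x = q \<cdot> y" using xy(3) by auto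
    have "p \<cdot> x = p \<cdot> y"
      by (rule monoD[OF exact(3) mp]) (use ty m' xy in auto)
    then show "x = y"
      by (rule biproduct_ext[OF S, rotated 4]) (use q m' xy in auto)
  qed (rule m')
  have epi: "is_epi C c'"
    unfolding is_epi_def
  proof (intro conjI ballI impI)
    fix x y assume xy: "x \<in> Arr C" "y \<in> Arr C"
      "Dom C x = Cod C c' \<and> Dom C y = Cod C c' \<and> Cod C x = Cod C y \<and> x \<cdot> c' = y \<cdot> c'"
    have "x \<cdot> c = (x \<cdot> c') \<cdot> i'" "y \<cdot> c = (y \<cdot> c') \<cdot> i'"
      using ty c' xy(1,2) conjunct1[OF xy(3)] conjunct1[OF conjunct2[OF xy(3)]]
      by (simp_all add: Comp_assoc_Arr ci)
    then have "x \<cdot> c = y \<cdot> c" using xy(3) by simp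
    then show "x = y"
      by (rule epiD[OF exact(4)]) (use ty c' xy in auto)
  qed (rule c')
  have ker: "is_kernel C m' c'"
  proof (rule kernelI[OF m'(1) c'(1) _ _ mono])
    fix h assume h: "h \<in> Arr C" "Cod C h = Dom C c'" "c' \<cdot> h = Null C (Dom C h) (Cod C c')"
    have "c \<cdot> (p' \<cdot> h) = Null C (Dom C h) L"
      using h c' ty by (simp add: c'_def Comp_assoc_Arr)
    then obtain u where u: "u \<in> Arr C" "Dom C u = Dom C h" "Cod C u = M" "m \<cdot> u = p' \<cdot> h"
      using kernel_factor[OF exact(1), of "p' \<cdot> h"] h c' ty by auto
    have "u \<in> Hom C (Dom C h) M" "q' \<cdot> h \<in> Hom C (Dom C h) V"
      using u h c' ty by (simp_all add: Hom_iff)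
    then obtain w where w: "w \<in> Arr C" "Dom C w = Dom C h" "Cod C w = S" "p \<cdot> w = u" "q \<cdot> w = q' \<cdot> h"
      using biproduct_pair[OF S] by metis
    have "m' \<cdot> w = h"
      by (rule biproduct_ext[OF T(2)]) (use ty m' w u h c' in \<open>simp_all add: assoc\<close>)
    then show "\<exists>u\<in>Arr C. Dom C u = Dom C h \<and> Cod C u = Dom C m' \<and> m' \<cdot> u = h"
      using w m' by auto
  qed (use m' c' cm' in auto)
  have coker: "is_cokernel C c' m'"
  proof (rule cokernelI[OF c'(1) m'(1) _ _ epi])
    fix h assume h: "h \<in> Arr C" "Dom C h = Cod C m'" "h \<cdot> m' = Null C (Dom C m') (Cod C h)"
    have "h \<cdot> (m' \<cdot> i) = Null C M (Cod C h)" "h \<cdot> (m' \<cdot> j) = Null C V (Cod C h)"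
      using h m' ty by (simp_all add: Comp_Comp_eq[OF h(3)])
    then have hi: "h \<cdot> (i' \<cdot> m) = Null C M (Cod C h)" and hj: "h \<cdot> j' = Null C V (Cod C h)"
      by (simp_all add: mi mj)
    obtain u where u: "u \<in> Arr C" "Dom C u = L" "Cod C u = Cod C h" "u \<cdot> c = h \<cdot> i'"
      using cokernel_factor[OF exact(2), of "h \<cdot> i'"] h hi m' ty by (auto simp: Comp_assoc_Arr)
    have "u \<cdot> c' = h"
      by (rule biproduct_coext[OF T(2)])
        (use ty m' u h hj c' in \<open>simp_all add: Comp_assoc_Arr ci cj\<close>)
    then show "\<exists>u\<in>Arr C. Cod C u = Cod C h \<and> Dom C u = Cod C c' \<and> u \<cdot> c' = h"
      using u c' by auto
  qed (use m' c' cm' in auto)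
  have "proper_ses C W m' c'"
  proof (rule proper_sesI[OF ker coker])
    show "Dom C c' \<in> W" using c' T by simp
    fix g assume g: "g \<in> Arr C" "Dom C g = Dom C m'" "Cod C g \<in> W"
    then obtain h where h: "h \<in> Arr C" "Dom C h = X" "Cod C h = Cod C g" "h \<cdot> m = g \<cdot> i"
      using proper_ses_extend[OF mc(1), of "g \<cdot> i"] ty m' by auto
    have "h \<in> Hom C X (Cod C g)" "g \<cdot> j \<in> Hom C V (Cod C g)"
      using h g m' ty by (simp_all add: Hom_iff)
    then obtain w where w: "w \<in> Arr C" "Dom C w = T" "Cod C w = Cod C g" "w \<cdot> i' = h" "w \<cdot> j' = g \<cdot> j"
      using biproduct_copair[OF T(2)] by metis
    have "w \<cdot> m' = g"
      by (rule biproduct_coext[OF S])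
        (use ty m' w h g in \<open>simp_all add: Comp_assoc_Arr mi mj Comp_Comp_eq[OF w(4)]\<close>)
    then show "\<exists>h\<in>Arr C. Dom C h = Dom C c' \<and> Cod C h = Cod C g \<and> h \<cdot> m' = g"
      using w c' by auto
  next
    fix g assume g: "g \<in> Arr C" "Cod C g = Cod C c'" "Dom C g \<in> W"
    then obtain v where v: "v \<in> Arr C" "Dom C v = Dom C g" "Cod C v = X" "c \<cdot> v = g"
      using proper_ses_lift[OF mc(1), of g] ty c' by auto
    have "c' \<cdot> (i' \<cdot> v) = g" using v ty c' by (simp add: Comp_Comp_eq[OF ci])
    then show "\<exists>h\<in>Arr C. Dom C h = Dom C g \<and> Cod C h = Dom C c' \<and> c' \<cdot> h = g"
      using v ty c' by (intro bexI[of _ "i' \<cdot> v"]) auto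
  qed
  then have "coresolved C W (Dom C m')"
    by (rule coresolved.intros) (use c' L mc(3) in auto)
  then show ?thesis using m' by simp
qed

end


section \<open>Retracts of coresolved objects\<close>

context abelian_category
begin

text \<open>The cokernel of \<open>N \<rightarrow> M \<rightarrow> V\<close> is a retract of \<open>K \<oplus> V\<close>, with the section \<open>(c', \<psi>)\<close> and the retraction
  \<open>(\<chi>, l)\<close>. The same arrows show that \<open>N \<rightarrow> V \<rightarrow> L\<close> is proper: an arrow \<open>g\<close> out of \<open>N\<close> is extended by
  extending \<open>g r\<close>, and an arrow \<open>u\<close> into \<open>L\<close> is lifted to \<open>\<phi> v + \<psi> u\<close>, where \<open>v\<close> is a lift of \<open>c' u\<close>.\<close>

lemma retract_coresolved_step:
  assumes W: "full_additive_subcategory C W"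
    and M: "coresolved C W M" and N: "retract C N M"
  obtains m c M' where "proper_ses C W m c" "Dom C m = N" "coresolved C W M'" "retract C (Cod C c) M'"
proof -
  obtain i r where ir: "N \<in> Obj C" "M \<in> Obj C" "i \<in> Arr C" "Dom C i = N" "Cod C i = M"
    "r \<in> Arr C" "Dom C r = M" "Cod C r = N" and ri: "r \<cdot> i = Id C N"
    using N unfolding retract_def Hom_def by auto
  obtain m c where mc: "proper_ses C W m c" "Dom C m = M" "coresolved C W (Cod C c)"
    using M by (cases rule: coresolved.cases) auto
  obtain V K where V: "V \<in> W" "V \<in> Obj C" and K: "K \<in> Obj C" "Cod C c = K"
    and m: "m \<in> Arr C" "Cod C m = V" and c: "c \<in> Arr C" "Dom C c = V"
    and cm: "c \<cdot> m = Null C M K"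
    and exact: "is_kernel C m c" "is_cokernel C c m" "is_mono C m" "is_epi C c"
    using proper_sesE[OF mc(1)] mc(2) by metis
  note ty = ir V(2) K m mc(2) c
  obtain l where l0: "is_cokernel C l (m \<cdot> i)" using ex_cokernel[of "m \<cdot> i"] ty by auto
  define L where "L = Cod C l"
  have l: "l \<in> Arr C" "Dom C l = V" "Cod C l = L" "L \<in> Obj C" and lmi: "l \<cdot> (m \<cdot> i) = Null C N L"
    using cokernelD[OF l0] ty by (simp_all add: L_def)
  have epi: "is_epi C l" by (rule cokernel_is_epi[OF l0])
  have mono: "is_mono C (m \<cdot> i)"
    unfolding is_mono_def
  proof (intro conjI ballI impI)
    show "m \<cdot> i \<in> Arr C" using ty by simp
    fix x y assume xy: "x \<in> Arr C" "y \<in> Arr C"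
      "Cod C x = Dom C (m \<cdot> i) \<and> Cod C y = Dom C (m \<cdot> i) \<and> Dom C x = Dom C y
        \<and> (m \<cdot> i) \<cdot> x = (m \<cdot> i) \<cdot> y"
    then have cod: "Cod C x = N" "Cod C y = N" "Dom C x = Dom C y" using ty by auto
    have "m \<cdot> (i \<cdot> x) = m \<cdot> (i \<cdot> y)"
      using xy(1,2) conjunct2[OF conjunct2[OF conjunct2[OF xy(3)]]] cod ty
      by (simp add: Comp_assoc_Arr)
    then have "i \<cdot> x = i \<cdot> y"
      by (rule monoD[OF exact(3)]) (use xy(1,2) cod ty in auto)
    then have "r \<cdot> (i \<cdot> x) = r \<cdot> (i \<cdot> y)" by simp
    then show "x = y"
      using xy(1,2) cod ty by (simp add: Comp_Comp_eq[OF ri])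
  qed
  note ty = ty l
  obtain \<phi> where \<phi>: "\<phi> \<in> Arr C" "Dom C \<phi> = V" "Cod C \<phi> = V" "\<phi> \<cdot> m = m \<cdot> (i \<cdot> r)"
    by (rule proper_ses_extend[OF mc(1), of "m \<cdot> (i \<cdot> r)"]) (use ty V in auto)
  \<comment> \<open>\<open>\<delta> = 1 - \<phi>\<close> vanishes on \<open>N\<close>, because \<open>\<phi> m i = m i r i = m i\<close>.\<close>
  obtain \<delta> where \<delta>: "\<delta> \<in> Arr C" "Dom C \<delta> = V" "Cod C \<delta> = V" "Plus C \<delta> \<phi> = Id C V"
    by (rule ex_difference[of "Id C V" \<phi>]) (use ty \<phi> in auto)
  have \<phi>mi: "\<phi> \<cdot> (m \<cdot> i) = m \<cdot> i"
    using ty \<phi>(1-3) by (simp add: Comp_Comp_eq[OF \<phi>(4)] Comp_assoc_Arr ri)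
  have "\<delta> \<cdot> (m \<cdot> i) = Null C N V"
  proof -
    have "Plus C (\<delta> \<cdot> (m \<cdot> i)) (\<phi> \<cdot> (m \<cdot> i)) = Plus C \<delta> \<phi> \<cdot> (m \<cdot> i)"
      by (rule Comp_Plus(1)[symmetric]) (use \<phi>(1-3) \<delta>(1-3) ty in auto)
    also have "\<dots> = Plus C (Null C N V) (m \<cdot> i)" using \<delta>(4) ty by simp
    finally have "Plus C (\<delta> \<cdot> (m \<cdot> i)) (m \<cdot> i) = Plus C (Null C N V) (m \<cdot> i)" by (simp only: \<phi>mi)
    then show ?thesis
      by (rule Plus_right_cancel[rotated -1]) (use \<delta>(1-3) ty in auto)
  qed
  then obtain \<psi> where \<psi>: "\<psi> \<in> Arr C" "Dom C \<psi> = L" "Cod C \<psi> = V" "\<psi> \<cdot> l = \<delta>"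
    using cokernel_factor[OF l0, of \<delta>] \<delta>(1-3) ty by auto
  have "c \<cdot> (m \<cdot> i) = Null C N K" using ty by (simp add: Comp_Comp_eq[OF cm])
  then obtain c' where c': "c' \<in> Arr C" "Dom C c' = L" "Cod C c' = K" "c' \<cdot> l = c"
    using cokernel_factor[OF l0, of c] ty by auto
  have "(l \<cdot> \<phi>) \<cdot> m = (l \<cdot> (m \<cdot> i)) \<cdot> r" using ty \<phi> by (simp add: Comp_assoc_Arr)
  then have "(l \<cdot> \<phi>) \<cdot> m = Null C M L" unfolding lmi using ty by simp
  then obtain \<chi> where \<chi>: "\<chi> \<in> Arr C" "Dom C \<chi> = K" "Cod C \<chi> = L" "\<chi> \<cdot> c = l \<cdot> \<phi>"
    using cokernel_factor[OF exact(2), of "l \<cdot> \<phi>"] \<phi>(1-3) ty by auto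
  note ty = ty \<phi>(1-3) \<delta>(1-3) \<psi>(1-3) c'(1-3) \<chi>(1-3)
  have id: "Plus C (\<chi> \<cdot> c') (l \<cdot> \<psi>) = Id C L"
  proof (rule epiD[OF epi])
    have "Plus C (\<chi> \<cdot> c') (l \<cdot> \<psi>) \<cdot> l = Plus C ((\<chi> \<cdot> c') \<cdot> l) ((l \<cdot> \<psi>) \<cdot> l)"
      by (rule Comp_Plus(1)) (use ty in auto)
    also have "\<dots> = Plus C (l \<cdot> \<phi>) (l \<cdot> \<delta>)"
      using ty by (simp add: Comp_assoc_Arr c'(4) \<psi>(4) \<chi>(4))
    also have "\<dots> = Plus C (l \<cdot> \<delta>) (l \<cdot> \<phi>)"
      by (rule Plus_comm) (use ty in auto)
    also have "\<dots> = l \<cdot> Plus C \<delta> \<phi>"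
      by (rule Comp_Plus(2)[symmetric]) (use ty in auto)
    also have "\<dots> = Id C L \<cdot> l" using \<delta>(4) ty by simp
    finally show "Plus C (\<chi> \<cdot> c') (l \<cdot> \<psi>) \<cdot> l = Id C L \<cdot> l" .
  qed (use ty in auto)
  obtain S a b p q where S: "is_biproduct C K V S a b p q" using ex_biproduct[of K V] ty by auto
  note b = biproductD[OF S]
  have "retract C L S"
  proof -
    have "c' \<in> Hom C L K" "\<psi> \<in> Hom C L V" "\<chi> \<in> Hom C K L" "l \<in> Hom C V L"
      using ty by (simp_all add: Hom_iff)
    then obtain s t where s: "s \<in> Arr C" "Dom C s = L" "Cod C s = S" "p \<cdot> s = c'" "q \<cdot> s = \<psi>"
      and t: "t \<in> Arr C" "Dom C t = S" "Cod C t = L" "t \<cdot> a = \<chi>" "t \<cdot> b = l"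
      using biproduct_pair[OF S] biproduct_copair[OF S] by metis
    have "t \<cdot> s = t \<cdot> Plus C (a \<cdot> c') (b \<cdot> \<psi>)"
      using biproduct_decomp[OF S s(1,3)] s(4,5) by simp
    also have "\<dots> = Plus C (t \<cdot> (a \<cdot> c')) (t \<cdot> (b \<cdot> \<psi>))"
      by (rule Comp_Plus(2)) (use ty b(1-15) t in auto)
    also have "\<dots> = Id C L"
      using ty b(1-15) t(1-3) id by (simp add: Comp_Comp_eq[OF t(4)] Comp_Comp_eq[OF t(5)])
    finally have "t \<cdot> s = Id C L" .
    moreover have "s \<in> Hom C L S" "t \<in> Hom C S L" using s t by (simp_all add: Hom_iff)
    ultimately show ?thesis
      unfolding retract_def using l(4) b(3) by blast
  qed
  moreover have "coresolved C W S"
    using coresolved_biproduct[OF W _ V(1) S] mc(3) K by simp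
  moreover have "proper_ses C W (m \<cdot> i) l"
  proof (rule proper_sesI[OF mono_is_kernel_of_cokernel[OF mono l0] l0])
    show "Dom C l \<in> W" using V l by simp
    fix g assume g: "g \<in> Arr C" "Dom C g = Dom C (m \<cdot> i)" "Cod C g \<in> W"
    then have dom: "Dom C g = N" using ty by simp
    obtain h where h: "h \<in> Arr C" "Dom C h = V" "Cod C h = Cod C g" "h \<cdot> m = g \<cdot> r"
      using proper_ses_extend[OF mc(1), of "g \<cdot> r"] ty g(1,3) dom by auto
    have "h \<cdot> (m \<cdot> i) = g"
      using ty h(1-3) g(1) dom by (simp add: Comp_Comp_eq[OF h(4)] Comp_assoc_Arr ri)
    then show "\<exists>h\<in>Arr C. Dom C h = Dom C l \<and> Cod C h = Cod C g \<and> h \<cdot> (m \<cdot> i) = g"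
      using h l by auto
  next
    fix u assume u: "u \<in> Arr C" "Cod C u = Cod C l" "Dom C u \<in> W"
    then have cod: "Cod C u = L" using l by simp
    obtain v where v: "v \<in> Arr C" "Dom C v = Dom C u" "Cod C v = V" "c \<cdot> v = c' \<cdot> u"
      using proper_ses_lift[OF mc(1), of "c' \<cdot> u"] ty u(1,3) cod by auto
    let ?w = "Plus C (\<phi> \<cdot> v) (\<psi> \<cdot> u)"
    have "l \<cdot> ?w = Plus C (l \<cdot> (\<phi> \<cdot> v)) (l \<cdot> (\<psi> \<cdot> u))"
      by (rule Comp_Plus(2)) (use ty u(1) cod v(1-3) in auto)
    also have "l \<cdot> (\<phi> \<cdot> v) = \<chi> \<cdot> (c \<cdot> v)"
      using ty v(1-3) by (simp add: Comp_Comp_eq[OF \<chi>(4)] Comp_assoc_Arr)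
    also have "Plus C (\<chi> \<cdot> (c \<cdot> v)) (l \<cdot> (\<psi> \<cdot> u)) = Plus C ((\<chi> \<cdot> c') \<cdot> u) ((l \<cdot> \<psi>) \<cdot> u)"
      using ty u(1) cod by (simp add: v(4) Comp_assoc_Arr)
    also have "\<dots> = Plus C (\<chi> \<cdot> c') (l \<cdot> \<psi>) \<cdot> u"
      by (rule Comp_Plus(1)[symmetric]) (use ty u(1) cod in auto)
    also have "\<dots> = u" using id u(1) cod by simp
    finally have "l \<cdot> ?w = u" .
    then show "\<exists>h\<in>Arr C. Dom C h = Dom C u \<and> Cod C h = Dom C l \<and> l \<cdot> h = u"
      using ty u(1) cod v(1-3) by (intro bexI[of _ ?w]) auto
  qed
  moreover have "Dom C (m \<cdot> i) = N" using ty by simp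
  ultimately show thesis using that l(3) by metis
qed

lemma coresolved_retract:
  assumes W: "full_additive_subcategory C W"
    and "coresolved C W M" "retract C N M"
  shows "coresolved C W N"
proof -
  have "\<exists>M. coresolved C W M \<and> retract C N M" using assms by blast
  then show ?thesis
  proof (coinduction arbitrary: N rule: coresolved.coinduct)
    case coresolved
    then obtain M where M: "coresolved C W M" "retract C N M" by blast
    obtain m c M' where "proper_ses C W m c" "Dom C m = N" "coresolved C W M'" "retract C (Cod C c) M'"
      by (rule retract_coresolved_step[OF W M])
    then show ?case by blast
  qed
qed

end


section \<open>Totally acyclic complexes as spliced short exact sequences\<close>

text \<open>The coinductive predicate unfolds to an actual sequence by dependent choice.\<close>

lemma coresolved_sequence:
  fixes C :: "('o, 'm, 'z) preadditive_data_scheme"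
  assumes "coresolved C W M"
  obtains m c :: "nat \<Rightarrow> 'm" where "\<And>n. proper_ses C W (m n) (c n)" "Dom C (m 0) = M"
    "\<And>n. Dom C (m (Suc n)) = Cod C (c n)"
proof -
  define P where "P N m c \<longleftrightarrow> Dom C m = N \<and> proper_ses C W m c \<and> coresolved C W (Cod C c)" for N m c
  have step: "\<exists>s. P N (fst s) (snd s)" if "coresolved C W N" for N
    using that by (cases rule: coresolved.cases) (auto simp: P_def)
  define R where "R n s \<longleftrightarrow> P (Dom C (fst s)) (fst s) (snd s) \<and> (n = 0 \<longrightarrow> Dom C (fst s) = M)"
    for n :: nat and s
  have "\<exists>f. \<forall>n. R n (f n) \<and> Dom C (fst (f (Suc n))) = Cod C (snd (f n))"
  proof (rule dependent_nat_choice)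
    obtain s where "P M (fst s) (snd s)" using step[OF assms] by blast
    then show "\<exists>s. R 0 s" unfolding R_def P_def by blast
  next
    fix s n assume "R n s"
    then have "coresolved C W (Cod C (snd s))" by (simp add: R_def P_def)
    then obtain t where "P (Cod C (snd s)) (fst t) (snd t)" using step by blast
    then show "\<exists>t. R (Suc n) t \<and> Dom C (fst t) = Cod C (snd s)" unfolding R_def P_def by auto
  qed
  then obtain f where "\<And>n. R n (f n)" "\<And>n. Dom C (fst (f (Suc n))) = Cod C (snd (f n))"
    by blast
  then show thesis
    by (intro that[of "fst \<circ> f" "snd \<circ> f"]) (simp_all add: R_def P_def)
qed

context preadditive_category
begin

lemma Comp_left_hom:
  assumes "g \<in> Arr C" "Dom C g = B" "Cod C g = D" "V \<in> Obj C"
  shows "(\<lambda>x. g \<cdot> x) \<in> hom (Hom_group C V B) (Hom_group C V D)"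
  unfolding hom_def Hom_group_def
  using assms Comp_in_Hom[of _ V B g D] Comp_Plus_right[of _ V B _ g D] by (auto simp: Hom_iff)

lemma exact_Hom_from_iff:
  assumes f: "f \<in> Arr C" "Dom C f = A" "Cod C f = B"
    and g: "g \<in> Arr C" "Dom C g = B" "Cod C g = D"
    and gf: "g \<cdot> f = Null C A D" and V: "V \<in> Obj C"
  shows "exact_seq ([Hom_group C V D, Hom_group C V B, Hom_group C V A],
      [\<lambda>x. g \<cdot> x, \<lambda>x. f \<cdot> x]) \<longleftrightarrow>
    (\<forall>x\<in>Hom C V B. g \<cdot> x = Null C V D \<longrightarrow> (\<exists>y\<in>Hom C V A. f \<cdot> y = x))"
proof -
  have Obj: "A \<in> Obj C" "B \<in> Obj C" "D \<in> Obj C" using f g by auto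
  have grp: "group (Hom_group C V A)" "group (Hom_group C V B)" "group (Hom_group C V D)"
    using Hom_comm_group[OF V] Obj by (simp_all add: comm_group_def)
  have hom: "(\<lambda>x. f \<cdot> x) \<in> hom (Hom_group C V A) (Hom_group C V B)"
    "(\<lambda>x. g \<cdot> x) \<in> hom (Hom_group C V B) (Hom_group C V D)"
    using Comp_left_hom f g V by auto
  have sub: "(\<lambda>x. f \<cdot> x) ` Hom C V A \<subseteq> {x \<in> Hom C V B. g \<cdot> x = Null C V D}"
    using f g V by (auto simp: Hom_iff Comp_Comp_eq[OF gf])
  have "exact_seq ([Hom_group C V D, Hom_group C V B, Hom_group C V A],
      [\<lambda>x. g \<cdot> x, \<lambda>x. f \<cdot> x]) \<longleftrightarrow>
    {x \<in> Hom C V B. g \<cdot> x = Null C V D} = (\<lambda>x. f \<cdot> x) ` Hom C V A"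
    using grp hom
    by (simp add: group_hom_def group_hom_axioms_def kernel_def Hom_group_def)
  also have "\<dots> \<longleftrightarrow> (\<forall>x\<in>Hom C V B. g \<cdot> x = Null C V D \<longrightarrow> (\<exists>y\<in>Hom C V A. f \<cdot> y = x))"
  proof
    assume "{x \<in> Hom C V B. g \<cdot> x = Null C V D} = (\<lambda>x. f \<cdot> x) ` Hom C V A"
    then show "\<forall>x\<in>Hom C V B. g \<cdot> x = Null C V D \<longrightarrow> (\<exists>y\<in>Hom C V A. f \<cdot> y = x)"
      by (metis (mono_tags, lifting) imageE mem_Collect_eq)
  next
    assume "\<forall>x\<in>Hom C V B. g \<cdot> x = Null C V D \<longrightarrow> (\<exists>y\<in>Hom C V A. f \<cdot> y = x)"
    then have "{x \<in> Hom C V B. g \<cdot> x = Null C V D} \<subseteq> (\<lambda>x. f \<cdot> x) ` Hom C V A"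
      by (fastforce simp: image_iff)
    with sub show "{x \<in> Hom C V B. g \<cdot> x = Null C V D} = (\<lambda>x. f \<cdot> x) ` Hom C V A"
      by (rule subset_antisym[rotated])
  qed
  finally show ?thesis .
qed

lemma exact_Hom_to_iff:
  assumes f: "f \<in> Arr C" "Dom C f = A" "Cod C f = B"
    and g: "g \<in> Arr C" "Dom C g = B" "Cod C g = D"
    and gf: "g \<cdot> f = Null C A D" and V: "V \<in> Obj C"
  shows "exact_seq ([Hom_group C A V, Hom_group C B V, Hom_group C D V],
      [\<lambda>x. x \<cdot> f, \<lambda>x. x \<cdot> g]) \<longleftrightarrow>
    (\<forall>x\<in>Hom C B V. x \<cdot> f = Null C A V \<longrightarrow> (\<exists>y\<in>Hom C D V. y \<cdot> g = x))"
  using preadditive_category.exact_Hom_from_iff[OF preadditive_category_opposite, of g D B f A V]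
    assms by simp

text \<open>The \<open>n\<close>-th short exact sequence has arrows \<open>a n\<close> into and \<open>b n\<close> out of its middle term, which becomes
  the \<open>n\<close>-th term of the complex. Composing with an epi does not change the cokernel and composing with
  a mono does not change the kernel, so the spliced differentials are exact. A cycle in \<open>Hom(V, X)\<close>
  factors through \<open>a n\<close>, hence lifts along \<open>b (n + 1)\<close> by properness; dually for \<open>Hom(X, V)\<close>.\<close>

lemma spliced_proper_ses_totally_acyclic:
  fixes a b :: "int \<Rightarrow> 'm"
  assumes W: "W \<subseteq> Obj C" and ses: "\<And>n. proper_ses C W (a n) (b n)"
    and glue: "\<And>n. Dom C (a n) = Cod C (b (n + 1))"
  shows "totally_acyclic C W (\<lambda>n. Dom C (b n)) (\<lambda>n. a (n - 1) \<cdot> b n)"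
    and "is_cokernel C (b n) (a n \<cdot> b (n + 1))"
proof -
  define X where "X n = Dom C (b n)" for n
  define Z where "Z n = Cod C (b n)" for n
  have ker: "is_kernel C (a n) (b n)" and coker: "is_cokernel C (b n) (a n)" and XW: "X n \<in> W" for n
    using ses[of n] by (auto simp: proper_ses_def X_def)
  have b: "b n \<in> Arr C" "Dom C (b n) = X n" "Cod C (b n) = Z n"
    and a: "a n \<in> Arr C" "Dom C (a n) = Z (n + 1)" "Cod C (a n) = X n"
    and X: "X n \<in> Obj C" and Z: "Z n \<in> Obj C"
    and ba: "b n \<cdot> a n = Null C (Z (n + 1)) (Z n)" for n
    using kernelD[OF ker[of n]] glue[of n] by (auto simp: X_def Z_def)
  have mono: "is_mono C (a n)" and epi: "is_epi C (b n)" for n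
    using kernel_is_mono[OF ker] cokernel_is_epi[OF coker] by auto
  define d where "d n = a (n - 1) \<cdot> b n" for n
  have a': "Dom C (a (n - 1)) = Z n" for n using a(2)[of "n - 1"] by simp
  have d: "d n \<in> Arr C" "Dom C (d n) = X n" "Cod C (d n) = X (n - 1)" for n
    using a[of "n - 1"] b[of n] by (simp_all add: d_def)
  have d_Suc: "d (n + 1) = a n \<cdot> b (n + 1)" for n by (simp add: d_def)
  have coker_d: "is_cokernel C (b n) (d (n + 1))" for n
    unfolding d_Suc
    by (subst cokernel_Comp_epi[OF epi]) (use a b coker in auto)
  then show "is_cokernel C (b n) (a n \<cdot> b (n + 1))" for n by (simp add: d_Suc)
  have ker_d: "is_kernel C (a n) (d n)" for n
    unfolding d_def by (rule kernel_mono_Comp[OF ker mono]) (simp add: a' b)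
  have dd: "d n \<cdot> d (n + 1) = Null C (X (n + 1)) (X (n - 1))" for n
  proof -
    have "d n \<cdot> d (n + 1) = (d n \<cdot> a n) \<cdot> b (n + 1)"
      unfolding d_Suc by (rule Comp_assoc_Arr[symmetric]) (use a b d in auto)
    then show ?thesis using kernelD(4)[OF ker_d] a b d X Z by simp
  qed
  have exact: "exact_at C (d (n + 1)) (d n)" for n
    unfolding exact_at_def is_image_def using d[of n] d[of "n + 1"] coker_d ker ker_d by auto
  have "exact_complex C X d"
    unfolding exact_complex_def Hom_iff using X d dd exact by simp
  moreover have "exact_seq ([Hom_group C V (X (n - 1)), Hom_group C V (X n), Hom_group C V (X (n + 1))],
        [\<lambda>f. d n \<cdot> f, \<lambda>f. d (n + 1) \<cdot> f])" if V: "V \<in> W" for V n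
  proof (subst exact_Hom_from_iff)
    show "\<forall>x\<in>Hom C V (X n). d n \<cdot> x = Null C V (X (n - 1)) \<longrightarrow>
        (\<exists>y\<in>Hom C V (X (n + 1)). d (n + 1) \<cdot> y = x)"
    proof (intro ballI impI)
      fix x assume x: "x \<in> Hom C V (X n)" "d n \<cdot> x = Null C V (X (n - 1))"
      then obtain u where u: "u \<in> Arr C" "Dom C u = V" "Cod C u = Z (n + 1)" "a n \<cdot> u = x"
        using kernel_factor[OF ker_d, of x n] d a by (auto simp: Hom_iff)
      then obtain y where y: "y \<in> Arr C" "Dom C y = V" "Cod C y = X (n + 1)" "b (n + 1) \<cdot> y = u"
        using proper_ses_lift[OF ses, of u "n + 1"] b V by auto
      have "d (n + 1) \<cdot> y = x"
        unfolding d_Suc using y u a b by (simp add: Comp_assoc_Arr)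
      then show "\<exists>y\<in>Hom C V (X (n + 1)). d (n + 1) \<cdot> y = x" using y by (auto simp: Hom_iff)
    qed
  qed (use d dd V W in auto)
  moreover have "exact_seq ([Hom_group C (X (n + 1)) V, Hom_group C (X n) V, Hom_group C (X (n - 1)) V],
        [\<lambda>f. f \<cdot> d (n + 1), \<lambda>f. f \<cdot> d n])" if V: "V \<in> W" for V n
  proof (subst exact_Hom_to_iff)
    show "\<forall>x\<in>Hom C (X n) V. x \<cdot> d (n + 1) = Null C (X (n + 1)) V \<longrightarrow>
        (\<exists>y\<in>Hom C (X (n - 1)) V. y \<cdot> d n = x)"
    proof (intro ballI impI)
      fix x assume x: "x \<in> Hom C (X n) V" "x \<cdot> d (n + 1) = Null C (X (n + 1)) V"
      then obtain u where u: "u \<in> Arr C" "Dom C u = Z n" "Cod C u = V" "u \<cdot> b n = x"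
        using cokernel_factor[OF coker_d, of x n] d b by (auto simp: Hom_iff)
      then obtain y where y: "y \<in> Arr C" "Dom C y = X (n - 1)" "Cod C y = V" "y \<cdot> a (n - 1) = u"
        using proper_ses_extend[OF ses, of u "n - 1"] a' b V by auto
      have "y \<cdot> d n = x"
        unfolding d_def using y u a a' b by (simp add: Comp_Comp_eq[OF y(4)])
      then show "\<exists>y\<in>Hom C (X (n - 1)) V. y \<cdot> d n = x" using y by (auto simp: Hom_iff)
    qed
  qed (use d dd V W in auto)
  ultimately have "totally_acyclic C W X d"
    unfolding totally_acyclic_def using XW by blast
  then show "totally_acyclic C W (\<lambda>n. Dom C (b n)) (\<lambda>n. a (n - 1) \<cdot> b n)"
    unfolding X_def d_def .
qed

end

context abelian_category
begin

text \<open>Conversely the cokernels \<open>b n\<close> of the differentials cut the complex into short exact sequences: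
  \<open>b (n + 1)\<close> is the coimage of \<open>d (n + 1)\<close>, so the induced arrow \<open>a n\<close> is mono by \<open>coimage_mono\<close>.
  An arrow \<open>g\<close> out of the domain of \<open>a n\<close> is extended along \<open>a n\<close> by observing that \<open>g \<cdot> b (n + 1)\<close> is a
  cycle of \<open>Hom(X, U)\<close>, hence factors through \<open>d (n + 1)\<close>; dually, an arrow into the target of
  \<open>b n\<close> becomes a cycle of \<open>Hom(U, X)\<close> after composition with \<open>a (n - 1)\<close>.\<close>

lemma totally_acyclic_splits:
  assumes W: "W \<subseteq> Obj C" and ta: "totally_acyclic C W X d"
  obtains a b where "\<And>n::int. proper_ses C W (a n) (b n)"
    "\<And>n. Dom C (a n) = Cod C (b (n + 1))" "\<And>n. is_cokernel C (b n) (d (n + 1))"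
proof -
  have X: "X n \<in> Obj C" and d: "d n \<in> Arr C" "Dom C (d n) = X n" "Cod C (d n) = X (n - 1)"
    and dd: "d n \<cdot> d (n + 1) = Null C (X (n + 1)) (X (n - 1))"
    and ex: "exact_at C (d (n + 1)) (d n)" and XW: "X n \<in> W" for n
    using ta unfolding totally_acyclic_def exact_complex_def Hom_iff by auto
  have d1: "Cod C (d (n + 1)) = X n" for n using d(3)[of "n + 1"] by simp
  have lift: "\<exists>y\<in>Hom C V (X (n + 1)). d (n + 1) \<cdot> y = x"
    if "V \<in> W" "x \<in> Hom C V (X n)" "d n \<cdot> x = Null C V (X (n - 1))" for V x n
    using ta that exact_Hom_from_iff[of "d (n + 1)" "X (n + 1)" "X n" "d n" "X (n - 1)" V] d d1 dd W
    unfolding totally_acyclic_def by blast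
  have extend: "\<exists>y\<in>Hom C (X (n - 1)) V. y \<cdot> d n = x"
    if "V \<in> W" "x \<in> Hom C (X n) V" "x \<cdot> d (n + 1) = Null C (X (n + 1)) V" for V x n
    using ta that exact_Hom_to_iff[of "d (n + 1)" "X (n + 1)" "X n" "d n" "X (n - 1)" V] d d1 dd W
    unfolding totally_acyclic_def by blast
  have "\<exists>c k. is_cokernel C c (d (n + 1)) \<and> is_kernel C k c \<and> is_kernel C k (d n)" for n
    using ex[of n] unfolding exact_at_def is_image_def by blast
  then obtain b k where b0: "\<And>n. is_cokernel C (b n) (d (n + 1))"
    and k: "\<And>n. is_kernel C (k n) (b n)" "\<And>n. is_kernel C (k n) (d n)"
    by metis
  define Z where "Z n = Cod C (b n)" for n
  have b: "b n \<in> Arr C" "Dom C (b n) = X n" "Cod C (b n) = Z n" "Z n \<in> Obj C" for n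
    using cokernelD[OF b0[of n]] d1[of n] by (auto simp: Z_def)
  have bd: "b n \<cdot> d (n + 1) = Null C (X (n + 1)) (Z n)" for n
    using cokernelD(4)[OF b0[of n]] d b by simp
  have epi: "is_epi C (b n)" for n by (rule cokernel_is_epi[OF b0])
  have "\<exists>a. a \<in> Arr C \<and> Dom C a = Z (n + 1) \<and> Cod C a = X n \<and> a \<cdot> b (n + 1) = d (n + 1)" for n
  proof -
    have "d (n + 1) \<cdot> d (n + 1 + 1) = Null C (X (n + 1 + 1)) (X n)" using dd[of "n + 1"] by simp
    then show ?thesis
      using cokernel_factor[OF b0[of "n + 1"], of "d (n + 1)"] d[of "n + 1"] d[of "n + 1 + 1"] d1 b
      by (metis add_diff_cancel_right')
  qed
  then obtain a where a: "\<And>n. a n \<in> Arr C" "\<And>n. Dom C (a n) = Z (n + 1)" "\<And>n. Cod C (a n) = X n"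
    and ab: "\<And>n. a n \<cdot> b (n + 1) = d (n + 1)"
    by metis
  have mono: "is_mono C (a n)" for n
    by (rule coimage_mono[OF cokernel_of_kernel[OF b0 k(1)] k(2)[of "n + 1"]]) (use a b ab in auto)
  have coker: "is_cokernel C (b n) (a n)" for n
    using b0[of n] cokernel_Comp_epi[OF epi[of "n + 1"], of "a n" "b n"] a b ab by simp
  have ker: "is_kernel C (a n) (b n)" for n
    by (rule mono_is_kernel_of_cokernel[OF mono coker])
  have "proper_ses C W (a n) (b n)" for n
  proof (rule proper_sesI[OF ker coker])
    show "Dom C (b n) \<in> W" using XW b by simp
    fix g assume g: "g \<in> Arr C" "Dom C g = Dom C (a n)" "Cod C g \<in> W"
    then have dom: "Dom C g = Z (n + 1)" using a by simp
    have "(g \<cdot> b (n + 1)) \<cdot> d (n + 1 + 1) = g \<cdot> (b (n + 1) \<cdot> d (n + 1 + 1))"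
      by (rule Comp_assoc_Arr) (simp_all only: b d dom g(1) add_diff_cancel_right')
    also have "\<dots> = g \<cdot> Null C (X (n + 1 + 1)) (Z (n + 1))" by (simp only: bd)
    finally have "(g \<cdot> b (n + 1)) \<cdot> d (n + 1 + 1) = Null C (X (n + 1 + 1)) (Cod C g)"
      using g(1) dom X by simp
    moreover have "g \<cdot> b (n + 1) \<in> Hom C (X (n + 1)) (Cod C g)"
      using g(1) dom b by (simp add: Hom_iff)
    ultimately obtain h where h: "h \<in> Hom C (X n) (Cod C g)" "h \<cdot> d (n + 1) = g \<cdot> b (n + 1)"
      using extend[of "Cod C g" "g \<cdot> b (n + 1)" "n + 1"] g(3) by auto
    have "(h \<cdot> a n) \<cdot> b (n + 1) = g \<cdot> b (n + 1)"
      unfolding h(2)[symmetric] ab[symmetric]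
      by (rule Comp_assoc_Arr) (use h(1) a b in \<open>auto simp: Hom_iff\<close>)
    then have "h \<cdot> a n = g"
      by (rule epiD[OF epi]) (use h(1) a b g(1) dom in \<open>auto simp: Hom_iff\<close>)
    then show "\<exists>h\<in>Arr C. Dom C h = Dom C (b n) \<and> Cod C h = Cod C g \<and> h \<cdot> a n = g"
      using h(1) b by (auto simp: Hom_iff)
  next
    fix g assume g: "g \<in> Arr C" "Cod C g = Cod C (b n)" "Dom C g \<in> W"
    then have cod: "Cod C g = Z n" using b by simp
    \<comment> \<open>In terms of \<open>n'\<close> the indices match those of \<open>lift\<close> and \<open>ab\<close> literally.\<close>
    define n' where "n' = n - 1"
    have n: "n = n' + 1" by (simp add: n'_def)
    note g' = g(1) cod[unfolded n]
    have "d n' \<cdot> a n' = Null C (Z (n' + 1)) (X (n' - 1))"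
    proof (rule epiD[OF epi[of "n' + 1"]])
      have "(d n' \<cdot> a n') \<cdot> b (n' + 1) = d n' \<cdot> d (n' + 1)"
        unfolding ab[symmetric] by (rule Comp_assoc_Arr) (use a b d in auto)
      then show "(d n' \<cdot> a n') \<cdot> b (n' + 1) = Null C (Z (n' + 1)) (X (n' - 1)) \<cdot> b (n' + 1)"
        using b X dd[of n'] by simp
    qed (use a b d X in auto)
    from Comp_Comp_eq[OF this, of g]
    have "d n' \<cdot> (a n' \<cdot> g) = Null C (Dom C g) (X (n' - 1))"
      using g' a b d X by simp
    moreover have "a n' \<cdot> g \<in> Hom C (Dom C g) (X n')"
      using g' a by (simp add: Hom_iff)
    ultimately obtain v where v: "v \<in> Hom C (Dom C g) (X (n' + 1))" "d (n' + 1) \<cdot> v = a n' \<cdot> g"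
      using lift[of "Dom C g" "a n' \<cdot> g" n'] g(3) by auto
    have "a n' \<cdot> (b (n' + 1) \<cdot> v) = a n' \<cdot> g"
      unfolding v(2)[symmetric] ab[symmetric]
      by (rule Comp_assoc_Arr[symmetric]) (use v(1) a b in \<open>auto simp: Hom_iff\<close>)
    then have "b (n' + 1) \<cdot> v = g"
      by (rule monoD[OF mono]) (use v(1) a b g' in \<open>auto simp: Hom_iff\<close>)
    then show "\<exists>h\<in>Arr C. Dom C h = Dom C g \<and> Cod C h = Dom C (b n) \<and> b n \<cdot> h = g"
      using v(1) b unfolding n by (auto simp: Hom_iff)
  qed
  then show thesis
    by (rule that) (use a b b0 in auto)
qed

text \<open>A complex is cut at the cokernel of \<open>d 1\<close>; since membership in \<open>\<G>(\<W>)\<close> is only up to isomorphism, and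
  an isomorphic object is a retract, closure under retracts transports both halves to \<open>M\<close>. Conversely
  the two halves are numbered by the negative and the nonnegative integers and spliced at \<open>M\<close>.\<close>

lemma Gorenstein_iff_coresolved:
  assumes W: "full_additive_subcategory C W"
  shows "M \<in> Gorenstein C W \<longleftrightarrow> coresolved C W M \<and> coresolved (opposite C) W M"
proof
  have WO: "W \<subseteq> Obj C" using W by (simp add: full_additive_subcategory_def)
  assume "M \<in> Gorenstein C W"
  then obtain X d c where ta: "totally_acyclic C W X d" and c: "is_cokernel C c (d 1)"
    and iso: "isomorphic C M (Cod C c)"
    unfolding Gorenstein_def by blast
  obtain a b where ses: "\<And>n. proper_ses C W (a n) (b n)"
    and glue: "\<And>n. Dom C (a n) = Cod C (b (n + 1))" and b: "\<And>n. is_cokernel C (b n) (d (n + 1))"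
    using totally_acyclic_splits[OF WO ta] by metis
  have right: "coresolved C W (Cod C (b n))" for n
  proof (coinduction arbitrary: n rule: coresolved.coinduct)
    case coresolved
    have "Cod C (b n) = Dom C (a (n - 1))" using glue[of "n - 1"] by simp
    then show ?case using ses[of "n - 1"] by blast
  qed
  have left: "coresolved (opposite C) W (Cod C (b n))" for n
  proof (coinduction arbitrary: n rule: coresolved.coinduct)
    case coresolved
    have "proper_ses (opposite C) W (b n) (a n)" using ses by simp
    moreover have "Cod (opposite C) (a n) = Cod C (b (n + 1))" using glue by simp
    ultimately show ?case by (metis opposite_simps(3))
  qed
  have "retract C M (Cod C (b 0))"
  proof -
    obtain f g where fg: "f \<in> Hom C M (Cod C c)" "g \<in> Hom C (Cod C c) M" "g \<cdot> f = Id C M"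
      and M: "M \<in> Obj C"
      using iso unfolding isomorphic_def by blast
    note cD = cokernelD[OF c] and bD = cokernelD[OF b[of 0]]
    obtain u where u: "u \<in> Arr C" "Dom C u = Cod C c" "Cod C u = Cod C (b 0)" "u \<cdot> c = b 0"
      using cokernel_factor[OF c, of "b 0"] bD by auto
    obtain v where v: "v \<in> Arr C" "Dom C v = Cod C (b 0)" "Cod C v = Cod C c" "v \<cdot> b 0 = c"
      using cokernel_factor[OF b[of 0], of c] cD by auto
    have "v \<cdot> u = Id C (Cod C c)"
      by (rule epiD[OF cokernel_is_epi[OF c]])
        (use u v cD(1) in \<open>simp_all add: Comp_assoc_Arr\<close>)
    then have "(g \<cdot> v) \<cdot> (u \<cdot> f) = Id C M"
      using fg u v by (simp add: Hom_iff Comp_assoc_Arr Comp_Comp_eq[of v u "Id C (Cod C c)" f])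
    moreover have "u \<cdot> f \<in> Hom C M (Cod C (b 0))" "g \<cdot> v \<in> Hom C (Cod C (b 0)) M"
      using fg u v by (simp_all add: Hom_iff)
    ultimately show ?thesis unfolding retract_def using M bD(1) by (meson Cod_Obj)
  qed
  then show "coresolved C W M \<and> coresolved (opposite C) W M"
    using coresolved_retract[OF W right]
      abelian_category.coresolved_retract[OF abelian_category_opposite
        full_additive_subcategory_opposite[OF W] left] by simp
next
  have WO: "W \<subseteq> Obj C" using W by (simp add: full_additive_subcategory_def)
  assume M: "coresolved C W M \<and> coresolved (opposite C) W M"
  obtain aR bR where R: "\<And>n. proper_ses C W (aR n) (bR n)" "Dom C (aR 0) = M"
    "\<And>n. Dom C (aR (Suc n)) = Cod C (bR n)"
    using coresolved_sequence[of C W M] M by metis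
  obtain bL aL where L: "\<And>n. proper_ses C W (aL n) (bL n)" "Cod C (bL 0) = M"
    "\<And>n. Cod C (bL (Suc n)) = Dom C (aL n)"
    using coresolved_sequence[of "opposite C" W M] M unfolding proper_ses_opposite opposite_simps
    by metis
  \<comment> \<open>Nonnegative indices belong to the resolution; the first step of the coresolution has index \<open>- 1\<close>,
    so that \<open>M\<close> is the cokernel of the differential with index \<open>1\<close>.\<close>
  define a where "a n = (if n \<ge> 0 then aL (nat n) else aR (nat (- 1 - n)))" for n :: int
  define b where "b n = (if n \<ge> 0 then bL (nat n) else bR (nat (- 1 - n)))" for n :: int
  have ses: "proper_ses C W (a n) (b n)" for n using R L by (simp add: a_def b_def)
  have glue: "Dom C (a n) = Cod C (b (n + 1))" for n
  proof -
    consider "n \<ge> 0" | "n = - 1" | "n < - 1" by linarith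
    then show ?thesis
    proof cases
      case 1
      then show ?thesis using L(3)[of "nat n"] by (simp add: a_def b_def nat_add_distrib)
    next
      case 2
      then show ?thesis using R(2) L(2) by (simp add: a_def b_def)
    next
      case 3
      then have "nat (- 1 - n) = Suc (nat (- 1 - (n + 1)))" by linarith
      then show ?thesis using R(3)[of "nat (- 1 - (n + 1))"] 3 by (simp add: a_def b_def)
    qed
  qed
  note splice = spliced_proper_ses_totally_acyclic[of W a b, OF WO ses glue]
  have M0: "Cod C (b 0) = M" using L(2) by (simp add: b_def)
  have "M \<in> Obj C" using proper_sesE[OF ses[of 0]] M0 by metis
  then have "isomorphic C M (Cod C (b 0))"
    unfolding isomorphic_def M0 using Id_in_Hom Id_left by metis
  moreover have "is_cokernel C (b 0) (a (1 - 1) \<cdot> b 1)" using splice(2)[of 0] by simp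
  ultimately show "M \<in> Gorenstein C W"
    unfolding Gorenstein_def using splice(1) by blast
qed

end

lemma biproduct_retract:
  assumes "is_biproduct C A B S i j p q"
  shows "retract C A S"
  using assms unfolding is_biproduct_def retract_def by blast

theorem proposition4p11:
  fixes \<A> :: "('o, 'm, 'z) preadditive_data_scheme"
    and \<W> :: "'o set"
  assumes "abelian_category \<A>"
    and "full_additive_subcategory \<A> \<W>"
    and "Ext_orthogonal \<A> \<W> \<W>"
  shows "closed_under_direct_summands \<A> (Gorenstein \<A> \<W>)"
  unfolding closed_under_direct_summands_def
proof (intro ballI allI impI)
  fix M N N' i j p q
  assume M: "M \<in> Gorenstein \<A> \<W>" and sum: "is_biproduct \<A> N N' M i j p q"
  interpret abelian_category \<A> by (rule assms(1))
  interpret op: abelian_category "opposite \<A>" by (rule abelian_category_opposite)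
  note W = assms(2) and W_op = full_additive_subcategory_opposite[OF assms(2)]
  have "retract \<A> N M" by (rule biproduct_retract[OF sum])
  then have "coresolved \<A> \<W> N" "coresolved (opposite \<A>) \<W> N"
    using M coresolved_retract[OF W] op.coresolved_retract[OF W_op]
    by (auto simp: Gorenstein_iff_coresolved[OF W])
  then show "N \<in> Gorenstein \<A> \<W>"
    by (simp add: Gorenstein_iff_coresolved[OF W])
qed

end
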